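(* Let $Q_0(x)=x^3+ax+b$, $\Delta=4a^3+27b^2\neq0$, $E_{a,b}:y^2=Q_0(x)$, and let $Z_0(\gamma)=\oint_\gamma\sqrt{Q_0}\,dx$ and $$Z_2(\gamma)=\oint_\gamma\Bigl(\frac{Q_0''}{8Q_0^{3/2}}-\frac{5Q_0'^2}{32Q_0^{5/2}}\Bigr)dx .$$ Then for every $\gamma\in H_1(E_{a,b},\mathbb{Z})$, exactly, $$Z_2(\gamma)=\frac{a^2}{4\Delta}A(\gamma)-\frac{9b}{8\Delta}B(\gamma),\qquad A(\gamma)=\oint_\gamma\frac{dx}{y},\quad B(\gamma)=\oint_\gamma\frac{x\,dx}{y},$$ and equivalently $$Z_2=\frac1{24}\bigl\{\log\Delta,\,Z_0\bigr\},\qquad\{f,g\}:=\frac{\partial f}{\partial a}\frac{\partial g}{\partial b}-\frac{\partial f}{\partial b}\frac{\partial g}{\partial a}.$$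
   Context: $(a,b)\in\mathbb{C}^2$; primes on $Q_0$ are $d/dx$; $\sqrt{Q_0}=y$ on the curve, so half-integer powers of $Q_0$ are odd powers of $y$. Derivatives in $a,b$ of periods are taken along locally constant $\gamma$; $A=2\partial_bZ_0$, $B=2\partial_aZ_0$. *)

theory Defs
  imports "HOL-Analysis.Analysis" "HOL-Homology.Homology"
begin

definition Q :: "complex \<Rightarrow> complex \<Rightarrow> complex \<Rightarrow> complex" where
  "Q a b x = x ^ 3 + a * x + b"

definition Disc :: "complex \<Rightarrow> complex \<Rightarrow> complex" where
  "Disc a b = 4 * a ^ 3 + 27 * b ^ 2"

(* The affine curve. Filling in the single point at infinity does not change H_1 when
   Disc a b is nonzero, so this is also the first homology of the compact elliptic curve. *)
definition E :: "complex \<Rightarrow> complex \<Rightarrow> (complex \<times> complex) set" where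
  "E a b = {(x, y). y ^ 2 = Q a b x}"

abbreviation H1 :: "complex \<Rightarrow> complex \<Rightarrow> (complex \<times> complex) chain set monoid" where
  "H1 a b \<equiv> homology_group 1 (top_of_set (E a b))"

(* A singular 1-simplex is a function of barycentric coordinates; this is the same path
   parametrised by [0,1], running from vertex 0 to vertex 1 as in chain_boundary. *)
definition edge_path :: "((nat \<Rightarrow> real) \<Rightarrow> 'a) \<Rightarrow> real \<Rightarrow> 'a" where
  "edge_path \<sigma> t = \<sigma> (\<lambda>i. if i = 0 then 1 - t else if i = 1 then t else 0)"

(* The integral of f(x,y) dx along g; cf. has_contour_integral, which is the case of a
   form in one complex variable. *)
definition integral_dx :: "(complex \<times> complex \<Rightarrow> complex) \<Rightarrow> (real \<Rightarrow> complex \<times> complex) \<Rightarrow> complex" where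
  "integral_dx f g =
     integral {0..1} (\<lambda>t. f (g t) * vector_derivative (\<lambda>u. fst (g u)) (at t within {0..1}))"

definition chain_integral_dx ::
    "(complex \<times> complex \<Rightarrow> complex) \<Rightarrow> (complex \<times> complex) chain \<Rightarrow> complex" where
  "chain_integral_dx f z =
     (\<Sum>\<sigma>\<in>Poly_Mapping.keys z. of_int (Poly_Mapping.lookup z \<sigma>) * integral_dx f (edge_path \<sigma>))"

(* The 1-chains along which all the forms below can be integrated: piecewise C^1 and away
   from the branch points y = 0, where the integrand of Z2 has (residue-free) poles.
   Every class in H_1 contains such a cycle. *)
definition admissible :: "(complex \<times> complex) chain \<Rightarrow> bool" where
  "admissible z \<longleftrightarrow>
     (\<forall>\<sigma>\<in>Poly_Mapping.keys z.
        valid_path (edge_path \<sigma>) \<and> (\<forall>t\<in>{0..1}. snd (edge_path \<sigma> t) \<noteq> 0))"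

(* On the curve y is the square root of Q, so Q^(3/2) and Q^(5/2) are y^3 and y^5. *)

definition Z0 :: "(complex \<times> complex) chain \<Rightarrow> complex" where
  "Z0 = chain_integral_dx (\<lambda>(x, y). y)"

definition Z2 :: "complex \<Rightarrow> complex \<Rightarrow> (complex \<times> complex) chain \<Rightarrow> complex" where
  "Z2 a b = chain_integral_dx
     (\<lambda>(x, y). deriv (deriv (Q a b)) x / (8 * y ^ 3) - 5 * (deriv (Q a b) x) ^ 2 / (32 * y ^ 5))"

definition A :: "(complex \<times> complex) chain \<Rightarrow> complex" where
  "A = chain_integral_dx (\<lambda>(x, y). 1 / y)"

definition B :: "(complex \<times> complex) chain \<Rightarrow> complex" where
  "B = chain_integral_dx (\<lambda>(x, y). x / y)"

definition chain_support :: "'a chain \<Rightarrow> 'a set" where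
  "chain_support z = (\<Union>\<sigma>\<in>Poly_Mapping.keys z. \<sigma> ` standard_simplex 1)"

(* \<Gamma> continues the cycle z on E a b to cycles on the neighbouring curves: the
   support of z is moved continuously, from its original position at (a,b), inside the
   curves E s t, and \<Gamma> s t is the push-forward of z. The homology classes of the
   \<Gamma> s t form the locally constant section through the class of z. *)
definition locally_constant_cycle ::
    "(complex \<times> complex) set \<Rightarrow> complex \<Rightarrow> complex \<Rightarrow> (complex \<times> complex) chain \<Rightarrow>
     (complex \<Rightarrow> complex \<Rightarrow> (complex \<times> complex) chain) \<Rightarrow> bool" where
  "locally_constant_cycle U a b z \<Gamma> \<longleftrightarrow>
     (\<exists>\<phi> :: complex \<times> complex \<Rightarrow> complex \<times> complex \<Rightarrow> complex \<times> complex.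
        continuous_on (U \<times> chain_support z) (\<lambda>(w, p). \<phi> w p) \<and>
        (\<forall>p\<in>chain_support z. \<phi> (a, b) p = p) \<and>
        (\<forall>(s, t)\<in>U. \<phi> (s, t) ` chain_support z \<subseteq> E s t \<and>
           \<Gamma> s t = chain_map 1 (\<phi> (s, t)) z \<and> admissible (\<Gamma> s t)))"

definition poisson_bracket ::
    "(complex \<Rightarrow> complex \<Rightarrow> complex) \<Rightarrow> (complex \<Rightarrow> complex \<Rightarrow> complex) \<Rightarrow> complex \<Rightarrow> complex \<Rightarrow> complex" where
  "poisson_bracket f g a b =
     deriv (\<lambda>s. f s b) a * deriv (\<lambda>t. g a t) b - deriv (\<lambda>t. f a t) b * deriv (\<lambda>s. g s b) a"

end

theory Submission
  imports Defs "HOL-Complex_Analysis.Complex_Analysis"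
begin

text \<open>With \<open>P = (9 b x\<^sup>2 / 4 + a\<^sup>2 x / 2 + 3 a b / 2) / \<Delta>\<close>, the form defining \<open>Z\<^sub>2\<close> differs from the stated
  combination of \<open>dx / y\<close> and \<open>x dx / y\<close> by the differential of \<open>5 Q' / (48 y\<^sup>3) + P / y\<close>, whose
  integral over a cycle vanishes.

  For the derivatives of \<open>Z\<^sub>0\<close>, cut each edge of the cycle into pieces over which \<open>y\<close> is a branch
  of \<open>sqrt Q\<close>, and replace each piece by a straight segment. When the parameters move, the polygon
  with the original vertices can be kept fixed: the error is a difference of endpoint terms that
  depend only on the vertices of the cycle, so it cancels in the sum. What remains is an integral over
  a fixed path of an integrand that is holomorphic in the parameters. In particular the dependence of the
  moving cycle on the parameters need only be continuous.

  Piecewise \<open>C\<^sup>1\<close> paths may have unbounded derivatives near the exceptional points, so integrability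
  along them is obtained from local primitives, not from continuity of the integrand.\<close>

subsection \<open>Local branches of the square root\<close>

text \<open>For nonzero \<open>c\<close>, the square root of \<open>q\<close> on the side of
  \<open>c\<close>: its quotient by \<open>c\<close> has nonnegative real part. The cut, where
  \<open>q / c ^ 2\<close> is real and nonpositive, misses the open disc about \<open>c ^ 2\<close>
  of radius \<open>norm c ^ 2\<close>.\<close>

definition branch :: "complex \<Rightarrow> complex \<Rightarrow> complex" where
  "branch c q = c * csqrt (q / c ^ 2)"

text \<open>The hypothesis puts \<open>v / c\<close> within distance 1 of 1, hence in the right
  half-plane, where \<open>csqrt\<close> undoes squaring. This is how values of \<open>y\<close> on
  the curve are recognised as branch values.\<close>

lemma branch_square_eq:
  assumes "norm (v - c) < norm c"
  shows "branch c (v ^ 2) = v"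
proof -
  have c: "c \<noteq> 0" using assms by auto
  have "v / c - 1 = (v - c) / c" using c by (simp add: diff_divide_distrib)
  then have "norm (v / c - 1) < 1"
    using assms c by (simp add: norm_divide)
  then have "Re (v / c) > 0"
    using abs_Re_le_cmod[of "v / c - 1"] by simp
  then have "csqrt ((v / c) ^ 2) = v / c"
    by (intro csqrt_square) auto
  then show ?thesis using c by (simp add: branch_def power_divide)
qed

lemma branch_power2: "c \<noteq> 0 \<Longrightarrow> branch c q ^ 2 = q"
  by (simp add: branch_def power_mult_distrib)

text \<open>Factor \<open>q - c ^ 2\<close> as (root minus \<open>c\<close>) times (root plus
  \<open>c\<close>); the second factor has norm at least \<open>norm c\<close> because the root lies
  on the side of \<open>c\<close>.\<close>

lemma norm_branch_diff_le:
  assumes "c \<noteq> 0"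
  shows "norm (branch c q - c) * norm c \<le> norm (q - c ^ 2)"
proof -
  let ?s = "branch c q / c"
  have "Re ?s \<ge> 0" using assms Re_csqrt by (simp add: branch_def)
  then have "norm (?s + 1) \<ge> 1"
    using complex_Re_le_cmod[of "?s + 1"] by simp
  moreover have "branch c q + c = c * (?s + 1)"
    using assms by (simp add: field_simps)
  ultimately have "norm (branch c q + c) \<ge> norm c"
    using mult_left_mono[of 1 "norm (?s + 1)" "norm c"] by (simp add: norm_mult)
  then have "norm (branch c q - c) * norm c \<le> norm (branch c q - c) * norm (branch c q + c)"
    by (simp add: mult_left_mono)
  also have "\<dots> = norm (branch c q ^ 2 - c ^ 2)"
    by (simp add: norm_mult[symmetric] power2_eq_square algebra_simps)
  finally show ?thesis using assms by (simp add: branch_power2)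
qed

text \<open>The root chosen by \<open>c\<close> is within \<open>\<rho> / 4\<close> of
  \<open>c\<close>, so within \<open>\<rho> / 2\<close> of \<open>c'\<close>, and
  \<open>branch_square_eq\<close> identifies it with the root chosen by \<open>c'\<close>. This
  glues branches taken at different vertices.\<close>

lemma branch_recenter:
  assumes "norm c \<ge> \<rho>" "norm c' \<ge> \<rho> / 2" "\<rho> > 0" "norm (c - c') < \<rho> / 4"
    and "norm (q - c ^ 2) < \<rho> ^ 2 / 4"
  shows "branch c' q = branch c q"
proof -
  have c: "c \<noteq> 0" using assms by auto
  have "norm (branch c q - c) * \<rho> \<le> norm (branch c q - c) * norm c"
    using assms by (simp add: mult_left_mono)
  also have "\<dots> < \<rho> / 4 * \<rho>"
    using norm_branch_diff_le[OF c, of q] assms by (simp add: power2_eq_square)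
  finally have "norm (branch c q - c) < \<rho> / 4" using assms by simp
  then have "norm (branch c q - c') < norm c'"
    using assms norm_triangle_ineq[of "branch c q - c" "c - c'"] by simp
  from branch_square_eq[OF this] show ?thesis using c by (simp add: branch_power2)
qed

lemma branch_arg_nonneg:
  fixes q c :: complex
  assumes "norm (q - c ^ 2) < norm c ^ 2"
  shows "q / c ^ 2 \<notin> \<real>\<^sub>\<le>\<^sub>0"
proof -
  have c: "c \<noteq> 0" using assms by auto
  have "norm (q / c ^ 2 - 1) = norm (q - c ^ 2) / norm (c ^ 2)"
    using c by (simp add: diff_divide_distrib flip: norm_divide)
  also have "\<dots> < 1" using assms c by (simp add: norm_power divide_simps)
  finally have "Re (q / c ^ 2) > 0"
    using abs_Re_le_cmod[of "q / c ^ 2 - 1"] by simp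
  then show ?thesis by (auto simp: complex_nonpos_Reals_iff)
qed

lemma branch_nonzero:
  assumes "norm (q - c ^ 2) < norm c ^ 2"
  shows "branch c q \<noteq> 0"
proof -
  have "c \<noteq> 0" using assms by auto
  moreover have "q / c ^ 2 \<noteq> 0" using branch_arg_nonneg[OF assms] by auto
  ultimately show ?thesis by (simp add: branch_def)
qed

lemma has_field_derivative_branch:
  assumes "norm (f x - c ^ 2) < norm c ^ 2" "(f has_field_derivative f') (at x within S)"
  shows "((\<lambda>x. branch c (f x)) has_field_derivative f' / (2 * branch c (f x))) (at x within S)"
proof -
  have c: "c \<noteq> 0" using assms by auto
  note n = branch_arg_nonneg[OF assms(1)]
  have "((\<lambda>x. f x / c ^ 2) has_field_derivative f' / c ^ 2) (at x within S)"
    using assms(2) by (rule DERIV_cdivide)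
  from DERIV_cmult[OF has_field_derivative_csqrt'[OF this n], of c] show ?thesis
    using c by (simp add: branch_def mult_ac power2_eq_square)
qed

lemma continuous_on_branch [continuous_intros]:
  assumes "continuous_on S f" "\<And>x. x \<in> S \<Longrightarrow> norm (f x - c ^ 2) < norm c ^ 2"
  shows "continuous_on S (\<lambda>x. branch c (f x))"
  unfolding branch_def
proof (cases "c = 0")
  case False
  have "continuous_on (f ` S) (\<lambda>q. csqrt (q / c ^ 2))"
    using assms(2) branch_arg_nonneg False
    by (auto intro!: continuous_at_imp_continuous_on continuous_intros isCont_o2[OF _ continuous_at_csqrt])
  then show "continuous_on S (\<lambda>x. c * csqrt (f x / c ^ 2))"
    using continuous_on_compose2[OF _ assms(1)] by (auto intro!: continuous_intros)
qed auto

subsection \<open>Integration along paths on the curve\<close>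

definition edge_integrand ::
    "(complex \<times> complex \<Rightarrow> complex) \<Rightarrow> (real \<Rightarrow> complex \<times> complex) \<Rightarrow> real \<Rightarrow> complex" where
  "edge_integrand f g t = f (g t) * vector_derivative (\<lambda>u. fst (g u)) (at t within {0..1})"

lemma integral_dx_eq: "integral_dx f g = integral {0..1} (edge_integrand f g)"
  by (simp add: integral_dx_def edge_integrand_def[abs_def])

text \<open>Fundamental theorem of calculus over one piece of the path, with a primitive in
  \<open>x\<close> alone. It yields integrability along with the value.\<close>

lemma edge_integrand_has_integral_primitive:
  assumes g: "valid_path g" and uv: "0 \<le> u" "u \<le> v" "v \<le> 1"
    and G: "\<And>x. x \<in> D \<Longrightarrow> (G has_field_derivative F x) (at x within D)"
    and D: "\<And>t. t \<in> {u..v} \<Longrightarrow> fst (g t) \<in> D" "\<And>t. t \<in> {u..v} \<Longrightarrow> f (g t) = F (fst (g t))"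
  shows "(edge_integrand f g has_integral G (fst (g v)) - G (fst (g u))) {u..v}"
proof -
  have "g piecewise_differentiable_on {0..1}"
    using g by (simp add: valid_path_def piecewise_C1_imp_differentiable)
  then have "(\<lambda>t. fst (g t)) piecewise_differentiable_on {0..1}"
    unfolding piecewise_differentiable_on_def differentiable_def
    by (blast intro: continuous_on_fst has_derivative_fst)
  then have "(\<lambda>t. fst (g t)) piecewise_differentiable_on {u..v}"
    by (rule piecewise_differentiable_on_subset) (use uv in auto)
  from contour_integral_primitive_lemma[OF uv(2) G this D(1)]
  have *: "((\<lambda>t. F (fst (g t)) * vector_derivative (\<lambda>t. fst (g t)) (at t within {u..v}))
     has_integral G (fst (g v)) - G (fst (g u))) {u..v}" by blast
  show ?thesis
  \<comment> \<open>The derivatives relative to \<open>{u..v}\<close> and to \<open>{0..1}\<close>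
    can differ only at \<open>u\<close> and \<open>v\<close>.\<close>
  proof (rule has_integral_spike_finite[OF _ _ *, of "{u, v}"])
    fix t assume t: "t \<in> {u..v} - {u, v}"
    then have "at t within {u..v} = at t" "at t within {0..1} = at t"
      using uv by (auto simp: at_within_Icc_at)
    then show "edge_integrand f g t =
        F (fst (g t)) * vector_derivative (\<lambda>t. fst (g t)) (at t within {u..v})"
      using D(2) t by (simp add: edge_integrand_def)
  qed auto
qed

lemma has_integral_mesh:
  fixes f :: "real \<Rightarrow> 'a::banach" and N :: nat
  assumes "N > 0" "\<And>i. i < N \<Longrightarrow> (f has_integral I i) {i / N..Suc i / N}"
  shows "(f has_integral (\<Sum>i<N. I i)) {0..1}"
proof -
  have "(f has_integral (\<Sum>i<k. I i)) {0..k / N}" if "k \<le> N" for k :: nat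
    using that
  proof (induction k)
    case (Suc k)
    show ?case unfolding sum.lessThan_Suc
      using Suc assms(2)[of k] by (intro has_integral_combine[of 0 "k / N" "Suc k / N"]) (auto simp: divide_simps)
  qed (use has_integral_refl(2) in auto)
  from this[of N] show ?thesis using assms by simp
qed

text \<open>A mesh so fine that each piece of \<open>g\<close> lies over a convex set on which the branch of
  the square root of \<open>q\<close> near the starting value of \<open>y\<close> is defined and gives \<open>y\<close>.\<close>

definition adapted ::
    "(complex \<Rightarrow> complex) \<Rightarrow> (real \<Rightarrow> complex \<times> complex) \<Rightarrow> nat \<Rightarrow> (nat \<Rightarrow> complex set) \<Rightarrow> bool" where
  "adapted q g N D \<longleftrightarrow> N > 0 \<and>
     (\<forall>i<N. open (D i) \<and> convex (D i) \<and>
        (\<forall>x\<in>D i. norm (q x - snd (g (i / N)) ^ 2) < norm (snd (g (i / N))) ^ 2) \<and>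
        (\<forall>t\<in>{i / N..Suc i / N}. fst (g t) \<in> D i \<and> snd (g t) ^ 2 = q (fst (g t)) \<and>
           norm (snd (g t) - snd (g (i / N))) < norm (snd (g (i / N)))))"

lemma adaptedD:
  assumes "adapted q g N D" "i < N"
  shows "open (D i)" "convex (D i)"
    "x \<in> D i \<Longrightarrow> norm (q x - snd (g (i / N)) ^ 2) < norm (snd (g (i / N))) ^ 2"
    "t \<in> {i / N..Suc i / N} \<Longrightarrow> fst (g t) \<in> D i"
    "t \<in> {i / N..Suc i / N} \<Longrightarrow> branch (snd (g (i / N))) (q (fst (g t))) = snd (g t)"
    "0 \<le> i / N" "i / N \<le> Suc i / N" "Suc i / N \<le> (1::real)"
proof -
  show "t \<in> {i / N..Suc i / N} \<Longrightarrow> branch (snd (g (i / N))) (q (fst (g t))) = snd (g t)"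
    using assms branch_square_eq unfolding adapted_def by metis
qed (use assms in \<open>auto simp: adapted_def divide_simps\<close>)

text \<open>On each piece, composing \<open>F\<close> with the local lift to the curve gives a
  primitive of the lifted form. The lift reproduces \<open>g\<close> at both ends, so the
  contributions telescope although the branch changes from piece to piece.\<close>

lemma edge_integrand_has_integral_exact:
  assumes g: "valid_path g" and ad: "adapted q g N D"
    and F: "\<And>c x. norm (q x - c ^ 2) < norm c ^ 2 \<Longrightarrow>
       ((\<lambda>x. F (x, branch c (q x))) has_field_derivative f (x, branch c (q x))) (at x)"
  shows "(edge_integrand f g has_integral F (g 1) - F (g 0)) {0..1}"
proof -
  have N: "N > 0" using ad by (simp add: adapted_def)
  have "(edge_integrand f g has_integral F (g (Suc i / N)) - F (g (i / N))) {i / N..Suc i / N}"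
    if i: "i < N" for i
  proof -
    note ad' = adaptedD[OF ad i]
    let ?h = "\<lambda>x. (x, branch (snd (g (i / N))) (q x))"
    have "(edge_integrand f g has_integral
       F (?h (fst (g (Suc i / N)))) - F (?h (fst (g (i / N))))) {i / N..Suc i / N}"
    proof (rule edge_integrand_has_integral_primitive[OF g ad'(6-8)])
      show "((\<lambda>x. F (?h x)) has_field_derivative f (?h x)) (at x within D i)" if "x \<in> D i" for x
        using F ad'(3)[OF that] has_field_derivative_at_within by blast
      fix t assume t: "t \<in> {i / N..Suc i / N}"
      show "fst (g t) \<in> D i" using ad'(4) t .
      show "f (g t) = f (?h (fst (g t)))" using ad'(5)[OF t] by simp
    qed
    then show ?thesis using ad'(5)[of "i/N"] ad'(5)[of "Suc i/N"] ad'(7) by (simp del: of_nat_Suc)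
  qed
  from has_integral_mesh[OF N this] have
    "(edge_integrand f g has_integral (\<Sum>i<N. F (g (Suc i / N)) - F (g (i / N)))) {0..1}" .
  also have "(\<Sum>i<N. F (g (Suc i / N)) - F (g (i / N))) = F (g 1) - F (g 0)"
    using sum_lessThan_telescope[of "\<lambda>i. F (g (i / N))" N] N by simp
  finally show ?thesis .
qed

text \<open>Each side carries its own branch, chosen by the value of \<open>y\<close> at its initial
  vertex. Only the values of \<open>g\<close> at the mesh points enter, so varying \<open>q\<close>
  leaves the path of integration fixed.\<close>

definition polygon_integral ::
    "(complex \<times> complex \<Rightarrow> complex) \<Rightarrow> (complex \<Rightarrow> complex) \<Rightarrow> nat \<Rightarrow>
     (real \<Rightarrow> complex \<times> complex) \<Rightarrow> complex" where
  "polygon_integral f q N g =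
     (\<Sum>i<N. contour_integral (linepath (fst (g (i / N))) (fst (g (Suc i / N))))
        (\<lambda>x. f (x, branch (snd (g (i / N))) (q x))))"

lemma contour_integral_linepath_primitive:
  assumes "convex D" "u \<in> D" "v \<in> D" "\<And>x. x \<in> D \<Longrightarrow> (G has_field_derivative F x) (at x within D)"
  shows "contour_integral (linepath u v) F = G v - G u"
proof (rule contour_integral_unique)
  have "closed_segment u v \<subseteq> D"
    using assms(1-3) by (simp add: closed_segment_subset)
  then show "(F has_contour_integral G v - G u) (linepath u v)"
    using contour_integral_primitive[OF assms(4) valid_path_linepath[of u v]] by simp
qed

text \<open>The lifted form is holomorphic on the convex open set \<open>D i\<close> and has a
  primitive there; the piece of the path and the segment with the same ends both integrate to the
  difference of that primitive.\<close>

lemma edge_integrand_has_integral_polygon: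
  assumes g: "valid_path g" and ad: "adapted q g N D"
    and F: "\<And>c x. norm (q x - c ^ 2) < norm c ^ 2 \<Longrightarrow>
       (\<lambda>x. f (x, branch c (q x))) field_differentiable (at x)"
  shows "(edge_integrand f g has_integral polygon_integral f q N g) {0..1}"
  unfolding polygon_integral_def
proof (rule has_integral_mesh)
  show "N > 0" using ad by (simp add: adapted_def)
  fix i assume i: "i < N"
  note ad' = adaptedD[OF ad i]
  let ?h = "\<lambda>x. f (x, branch (snd (g (i / N))) (q x))"
  have "?h field_differentiable at x within D i" if "x \<in> D i" for x
    using F ad'(3)[OF that] field_differentiable_at_within by blast
  then have "?h holomorphic_on D i" by (simp add: holomorphic_on_def)
  then obtain G where G: "\<And>x. x \<in> D i \<Longrightarrow> (G has_field_derivative ?h x) (at x within D i)"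
    using holomorphic_convex_primitive'[OF ad'(2,1)] by blast
  have "(edge_integrand f g has_integral G (fst (g (Suc i / N))) - G (fst (g (i / N)))) {i / N..Suc i / N}"
    by (rule edge_integrand_has_integral_primitive[OF g ad'(6-8) G]) (use ad'(4,5) in auto)
  moreover have "contour_integral (linepath (fst (g (i / N))) (fst (g (Suc i / N)))) ?h
      = G (fst (g (Suc i / N))) - G (fst (g (i / N)))"
    using ad'(2,4,7) by (intro contour_integral_linepath_primitive[OF _ _ _ G]) (auto simp del: of_nat_Suc)
  ultimately show "(edge_integrand f g has_integral
      contour_integral (linepath (fst (g (i / N))) (fst (g (Suc i / N)))) ?h) {i / N..Suc i / N}"
    by simp
qed

subsection \<open>Sums over chains\<close>

text \<open>The additive extension of \<open>h\<close> from simplices to chains, kept apart from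
  integration so that boundaries and push-forwards are handled by additivity alone.\<close>

definition weight_sum :: "('k \<Rightarrow> complex) \<Rightarrow> ('k \<Rightarrow>\<^sub>0 int) \<Rightarrow> complex" where
  "weight_sum h c = (\<Sum>k\<in>Poly_Mapping.keys c. of_int (Poly_Mapping.lookup c k) * h k)"

lemma weight_sum_superset:
  assumes "finite S" "Poly_Mapping.keys c \<subseteq> S"
  shows "weight_sum h c = (\<Sum>k\<in>S. of_int (Poly_Mapping.lookup c k) * h k)"
  unfolding weight_sum_def using assms
  by (intro sum.mono_neutral_left) (auto simp: in_keys_iff)

lemma weight_sum_0 [simp]: "weight_sum h 0 = 0"
  by (simp add: weight_sum_def)

lemma weight_sum_frag_of [simp]: "weight_sum h (frag_of k) = h k"
  by (simp add: weight_sum_def keys_frag_of)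

lemma weight_sum_diff: "weight_sum h (c - d) = weight_sum h c - weight_sum h d"
proof -
  let ?S = "Poly_Mapping.keys c \<union> Poly_Mapping.keys d"
  have "finite ?S" "Poly_Mapping.keys (c - d) \<subseteq> ?S" by (auto simp: keys_diff)
  then show ?thesis
    by (simp add: weight_sum_superset[of ?S] lookup_minus left_diff_distrib sum_subtractf)
qed

lemma weight_sum_frag_extend:
  "weight_sum h (frag_extend f c) = weight_sum (\<lambda>k. weight_sum h (f k)) c"
  using subset_UNIV
  by (induction c rule: frag_induction) (auto simp: frag_extend_diff weight_sum_diff)

lemma weight_sum_cong:
  "(\<And>k. k \<in> Poly_Mapping.keys c \<Longrightarrow> h k = h' k) \<Longrightarrow> weight_sum h c = weight_sum h' c"
  by (simp add: weight_sum_def)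

lemma weight_sum_add_fun: "weight_sum (\<lambda>k. h k + h' k) c = weight_sum h c + weight_sum h' c"
  by (simp add: weight_sum_def algebra_simps sum.distrib)

lemma weight_sum_cmult_fun: "weight_sum (\<lambda>k. r * h k) c = r * weight_sum h c"
  by (simp add: weight_sum_def algebra_simps sum_distrib_left)

lemma chain_integral_dx_eq: "chain_integral_dx f z = weight_sum (\<lambda>\<sigma>. integral_dx f (edge_path \<sigma>)) z"
  by (simp add: chain_integral_dx_def weight_sum_def)

lemma weight_sum_chain_map: "weight_sum h (chain_map p f z) = weight_sum (\<lambda>\<sigma>. h (simplex_map p f \<sigma>)) z"
  by (simp add: chain_map_def weight_sum_frag_extend)

section \<open>Edges of singular chains as paths, and their boundary\<close>

definition barycentric :: "real \<Rightarrow> nat \<Rightarrow> real" where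
  "barycentric t = (\<lambda>i. if i = 0 then 1 - t else if i = 1 then t else 0)"

lemma edge_path_eq: "edge_path \<sigma> t = \<sigma> (barycentric t)"
  by (simp add: edge_path_def barycentric_def)

lemma standard_simplex_1: "standard_simplex 1 = barycentric ` {0..1}"
proof (intro equalityI subsetI)
  fix x assume x: "x \<in> standard_simplex 1"
  then have "x 0 + x 1 = 1" by (simp add: standard_simplex_def)
  then have "x = barycentric (x 1)"
    using x by (auto simp: standard_simplex_def barycentric_def fun_eq_iff)
  then show "x \<in> barycentric ` {0..1}"
    using x by (auto simp: standard_simplex_def)
qed (auto simp: standard_simplex_def barycentric_def)

lemma edge_path_simplex_map:
  "t \<in> {0..1} \<Longrightarrow> edge_path (simplex_map 1 f \<sigma>) t = f (edge_path \<sigma> t)"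
  by (simp add: edge_path_eq simplex_map_def standard_simplex_1 del: One_nat_def)

lemma chain_support_eq: "chain_support z = (\<Union>\<sigma>\<in>Poly_Mapping.keys z. edge_path \<sigma> ` {0..1})"
  by (simp add: chain_support_def standard_simplex_1 image_image edge_path_eq del: One_nat_def)

text \<open>The boundary of an edge is its terminal minus its initial vertex, so the sum is the
  additive extension of \<open>h\<close> evaluated on the zero chain. Every cancellation of endpoint
  terms below comes from here.\<close>

lemma weight_sum_boundary:
  assumes "chain_boundary 1 z = 0"
  shows "weight_sum (\<lambda>\<sigma>. h (edge_path \<sigma> 1) - h (edge_path \<sigma> 0)) z = 0"
proof -
  \<comment> \<open>The only point of the standard 0-simplex; a 0-simplex is identified with its
    value there.\<close>
  let ?e = "\<lambda>i::nat. if i = 0 then 1 else 0 :: real"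
  have mem: "?e \<in> standard_simplex 0"
    by (auto simp: standard_simplex_def)
  have "singular_face (Suc 0) 0 \<sigma> ?e = edge_path \<sigma> 1"
       "singular_face (Suc 0) (Suc 0) \<sigma> ?e = edge_path \<sigma> 0" for \<sigma> :: "(nat \<Rightarrow> real) \<Rightarrow> 'a"
    using mem
    by (auto simp: singular_face_def edge_path_def simplical_face_def intro!: arg_cong[of _ _ \<sigma>])
  then have "weight_sum (\<lambda>\<tau>. h (\<tau> ?e)) (chain_boundary 1 z) =
      weight_sum (\<lambda>\<sigma>. h (edge_path \<sigma> 1) - h (edge_path \<sigma> 0)) z"
    by (simp add: chain_boundary_def weight_sum_frag_extend weight_sum_diff)
  then show ?thesis using assms by simp
qed

subsection \<open>Meshes stable under perturbation\<close>

lemma mesh_interval_subset: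
  fixes i N :: nat
  assumes "i < N"
  shows "{i / N..Suc i / N} \<subseteq> {0..1::real}"
proof -
  have "0 \<le> real i / N" "Suc i / N \<le> (1::real)"
    using assms by (simp_all add: divide_simps)
  then show ?thesis by auto
qed

lemma fine_partition:
  fixes G :: "(real \<Rightarrow> 'a::metric_space) set"
  assumes "finite G" "\<And>g. g \<in> G \<Longrightarrow> continuous_on {0..1} g" "\<delta> > 0"
  obtains N :: nat where "N > 0"
    "\<And>g i t. g \<in> G \<Longrightarrow> i < N \<Longrightarrow> t \<in> {i / N..Suc i / N} \<Longrightarrow> dist (g t) (g (i / N)) < \<delta>"
proof -
  have "\<exists>e>0. \<forall>t\<in>{0..1}. \<forall>s\<in>{0..1}. dist s t < e \<longrightarrow> dist (g s) (g t) < \<delta>" if "g \<in> G" for g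
    using compact_uniformly_continuous[OF assms(2)[OF that]] \<open>\<delta> > 0\<close>
    unfolding uniformly_continuous_on_def by auto
  then obtain e where e: "\<And>g. g \<in> G \<Longrightarrow> e g > 0"
      "\<And>g s t. g \<in> G \<Longrightarrow> s \<in> {0..1} \<Longrightarrow> t \<in> {0..1} \<Longrightarrow> dist s t < e g \<Longrightarrow> dist (g s) (g t) < \<delta>"
    by metis
  \<comment> \<open>The inserted 1 keeps the minimum meaningful when \<open>G\<close> is
    empty.\<close>
  define e0 where "e0 = Min (insert 1 (e ` G))"
  have e0: "e0 > 0" "\<And>g. g \<in> G \<Longrightarrow> e0 \<le> e g"
    using assms(1) e(1) by (auto simp: e0_def)
  obtain N :: nat where N: "1 / e0 < N" using reals_Archimedean2 by blast
  then have "N > 0" using e0(1) by (auto intro!: Nat.gr0I simp: not_less)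
  show ?thesis
  proof
    fix g i t assume g: "g \<in> G" and i: "i < N" and t: "t \<in> {i / N..Suc i / N}"
    have "1 / N < e0" using N e0(1) \<open>N > 0\<close> by (simp add: field_simps)
    moreover have "dist t (i / N) \<le> 1 / N"
      using t by (simp add: dist_real_def add_divide_distrib)
    ultimately have "dist t (i / N) < e g" using e0(2)[OF g] by simp
    moreover have "t \<in> {0..1}" "i / N \<in> {0..1::real}"
      using mesh_interval_subset[OF i] t i by (blast, simp add: divide_simps)
    ultimately show "dist (g t) (g (i / N)) < \<delta>"
      using e(2)[OF g] by blast
  qed fact
qed

text \<open>Compactness bounds \<open>y\<close> away from 0 on \<open>S\<close>, and
  \<open>Q\<close> is uniformly continuous jointly in the parameters and in \<open>x\<close> on
  compact sets; on the curve \<open>Q a b\<close> equals \<open>y ^ 2\<close>.\<close>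

lemma Q_near_compact:
  assumes S: "compact S" "S \<subseteq> E a b" "\<And>p. p \<in> S \<Longrightarrow> snd p \<noteq> 0"
  obtains \<rho> d where "\<rho> > 0" "d > 0" "\<And>p. p \<in> S \<Longrightarrow> \<rho> \<le> norm (snd p)"
    "\<And>p s t x. p \<in> S \<Longrightarrow> dist (s, t) (a, b) < d \<Longrightarrow> norm (x - fst p) < d \<Longrightarrow>
       norm (Q s t x - snd p ^ 2) < \<rho> ^ 2 / 4"
proof -
  obtain \<rho> where \<rho>: "\<rho> > 0" "\<And>p. p \<in> S \<Longrightarrow> \<rho> \<le> norm (snd p)"
  proof (cases "S = {}")
    case False
    have "continuous_on S (\<lambda>p. norm (snd p))" by (intro continuous_intros)
    then obtain p where "p \<in> S" "\<And>p'. p' \<in> S \<Longrightarrow> norm (snd p) \<le> norm (snd p')"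
      using continuous_attains_inf[OF S(1) False] by blast
    then show thesis using that[of "norm (snd p)"] S(3) zero_less_norm_iff by blast
  qed (use that[of 1] in auto)
  obtain M where M: "\<And>p. p \<in> S \<Longrightarrow> norm p \<le> M"
    using compact_imp_bounded[OF S(1)] by (auto simp: bounded_iff)
  \<comment> \<open>The extra 1 in both radii leaves room for parameters and points moved by less
    than 1.\<close>
  let ?K = "cball (a, b) 1 \<times> cball 0 (M + 1) :: ((complex \<times> complex) \<times> complex) set"
  let ?q = "\<lambda>v :: (complex \<times> complex) \<times> complex. Q (fst (fst v)) (snd (fst v)) (snd v)"
  have "uniformly_continuous_on ?K ?q"
    unfolding Q_def by (intro compact_uniformly_continuous continuous_intros compact_Times compact_cball)
  moreover have "\<rho> ^ 2 / 4 > 0" using \<rho>(1) by simp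
  ultimately have "\<exists>e>0. \<forall>v\<in>?K. \<forall>v'\<in>?K. dist v' v < e \<longrightarrow> dist (?q v') (?q v) < \<rho> ^ 2 / 4"
    unfolding uniformly_continuous_on_def by blast
  then obtain e where e: "e > 0" "\<And>v v'. v \<in> ?K \<Longrightarrow> v' \<in> ?K \<Longrightarrow> dist v' v < e \<Longrightarrow> dist (?q v') (?q v) < \<rho> ^ 2 / 4"
    by blast
  show ?thesis
  \<comment> \<open>Half of \<open>e\<close> each for the parameters and for \<open>x\<close>: the
    distance in the product is at most the sum of the two distances.\<close>
  proof (rule that[of \<rho> "min 1 (e / 2)"])
    fix p s t x assume p: "p \<in> S" and d: "dist (s, t) (a, b) < min 1 (e / 2)" "norm (x - fst p) < min 1 (e / 2)"
    have "norm (fst p) \<le> M" using M[OF p] norm_fst_le[of "fst p" "snd p"] by simp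
    moreover have "norm x \<le> norm (fst p) + norm (x - fst p)"
      using norm_triangle_ineq[of "fst p" "x - fst p"] by simp
    moreover have "dist ((s, t), x) ((a, b), fst p) \<le> dist (s, t) (a, b) + dist x (fst p)"
      unfolding dist_Pair_Pair[of "(s, t)"] by (rule sqrt_sum_squares_le_sum) auto
    ultimately have "dist (?q ((s, t), x)) (?q ((a, b), fst p)) < \<rho> ^ 2 / 4"
      using d by (intro e(2)) (auto simp: dist_commute dist_norm)
    moreover have "Q a b (fst p) = snd p ^ 2"
      using p S(2) by (auto simp: E_def)
    ultimately show "norm (Q s t x - snd p ^ 2) < \<rho> ^ 2 / 4"
      by (simp add: dist_norm)
  qed (use \<rho> e(1) in auto)
qed

text \<open>The bounds \<open>d / 2\<close> and \<open>\<rho> / 8\<close> are half budgets: the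
  other halves go to the displacement in \<open>shadows\<close>. Together they give
  \<open>d\<close>, the radius of the discs, and \<open>\<rho> / 4\<close>, the tolerance of
  \<open>branch_recenter\<close>.\<close>

definition fine_mesh :: "real \<Rightarrow> real \<Rightarrow> nat \<Rightarrow> (real \<Rightarrow> complex \<times> complex) \<Rightarrow> bool" where
  "fine_mesh \<rho> d N g \<longleftrightarrow> N > 0 \<and> \<rho> > 0 \<and> d > 0 \<and> (\<forall>t\<in>{0..1}. \<rho> \<le> norm (snd (g t))) \<and>
     (\<forall>i<N. \<forall>t\<in>{i / N..Suc i / N}. dist (g t) (g (i / N)) < min (d / 2) (\<rho> / 8))"

definition root_region ::
    "real \<Rightarrow> real \<Rightarrow> (complex \<Rightarrow> complex) \<Rightarrow> (real \<Rightarrow> complex \<times> complex) \<Rightarrow> bool" where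
  "root_region \<rho> d q g \<longleftrightarrow>
     (\<forall>t\<in>{0..1}. \<forall>x\<in>ball (fst (g t)) d. norm (q x - snd (g t) ^ 2) < \<rho> ^ 2 / 4)"

text \<open>Describes an edge \<open>k\<close> of the moved cycle relative to the original edge
  \<open>g\<close>. The condition is pointwise, so it also covers images that are not piecewise
  smooth.\<close>

definition shadows ::
    "real \<Rightarrow> real \<Rightarrow> (complex \<Rightarrow> complex) \<Rightarrow> (real \<Rightarrow> complex \<times> complex) \<Rightarrow>
     (real \<Rightarrow> complex \<times> complex) \<Rightarrow> bool" where
  "shadows \<rho> d q g k \<longleftrightarrow> (\<forall>t\<in>{0..1}. dist (k t) (g t) < min (d / 2) (\<rho> / 8) \<and>
      snd (k t) ^ 2 = q (fst (k t)))"

text \<open>By the triangle inequality both paths stay, over one mesh piece, in the disc about the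
  base vertex, with \<open>y\<close> within \<open>\<rho> / 4\<close> of its base value. Hence the
  base vertex, the next vertex and the moved vertex all select the same branch on that disc.\<close>

lemma shadows_mesh_point:
  assumes m: "fine_mesh \<rho> d N g" and r: "root_region \<rho> d q g" and s: "shadows \<rho> d q g k"
    and i: "i < N"
  shows "norm (snd (k (i / N))) \<ge> 7 / 8 * \<rho>"
    "t \<in> {i / N..Suc i / N} \<Longrightarrow> fst (k t) \<in> ball (fst (g (i / N))) d"
    "t \<in> {i / N..Suc i / N} \<Longrightarrow> fst (g t) \<in> ball (fst (g (i / N))) d"
    "t \<in> {i / N..Suc i / N} \<Longrightarrow> norm (snd (k t) - snd (g (i / N))) < \<rho> / 4"
    "t \<in> {i / N..Suc i / N} \<Longrightarrow> norm (snd (k t) - snd (k (i / N))) < 7 / 8 * \<rho>"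
    "x \<in> ball (fst (g (i / N))) d \<Longrightarrow> norm (q x - snd (k (i / N)) ^ 2) < (7 / 8 * \<rho>) ^ 2"
    "x \<in> ball (fst (g (i / N))) d \<Longrightarrow> branch (snd (k (i / N))) (q x) = branch (snd (g (i / N))) (q x)"
    "x \<in> ball (fst (g (i / N))) d \<Longrightarrow>
       branch (snd (g (Suc i / N))) (q x) = branch (snd (g (i / N))) (q x)"
proof -
  let ?u = "i / N :: real" and ?J = "{i / N..Suc i / N} :: real set"
  have pos: "\<rho> > 0" "d > 0" using m by (auto simp: fine_mesh_def)
  have J: "?u \<in> ?J" "Suc i / N \<in> ?J" "?J \<subseteq> {0..1}" and u: "?u \<in> {0..1}"
    using i by (auto simp: divide_simps)
  have kg: "dist (k t) (g t) < d / 2" "dist (k t) (g t) < \<rho> / 8" "snd (k t) ^ 2 = q (fst (k t))"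
    if "t \<in> {0..1}" for t using s that by (auto simp: shadows_def)
  have gg: "dist (g t) (g ?u) < d / 2" "dist (g t) (g ?u) < \<rho> / 8" if "t \<in> ?J" for t
    using m i that unfolding fine_mesh_def by auto
  have gn: "norm (snd (g t)) \<ge> \<rho>" if "t \<in> {0..1}" for t
    using m that unfolding fine_mesh_def by auto
  have gq: "norm (q x - snd (g t) ^ 2) < \<rho> ^ 2 / 4" if "t \<in> {0..1}" "x \<in> ball (fst (g t)) d" for t x
    using r that unfolding root_region_def by auto
  have le: "dist (fst p) (fst p') \<le> dist p p'" "norm (snd p - snd p') \<le> dist p p'"
    for p p' :: "complex \<times> complex"
    by (simp_all add: dist_fst_le dist_snd_le flip: dist_norm)
  show 1: "norm (snd (k ?u)) \<ge> 7 / 8 * \<rho>"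
    using gn[OF u] kg(2)[OF u] le(2)[of "k ?u" "g ?u"] norm_triangle_ineq2[of "snd (g ?u)" "snd (g ?u) - snd (k ?u)"]
    by (simp add: norm_minus_commute)
  have kg2: "dist (k t) (g ?u) < d" "dist (k t) (g ?u) < \<rho> / 4" if "t \<in> ?J" for t
  proof -
    have "t \<in> {0..1}" using that J(3) by blast
    from kg(1,2)[OF this] gg[OF that] show "dist (k t) (g ?u) < d" "dist (k t) (g ?u) < \<rho> / 4"
      using dist_triangle[of "k t" "g ?u" "g t"] by auto
  qed
  show 2: "fst (k t) \<in> ball (fst (g ?u)) d" if "t \<in> ?J" for t
    using le(1)[of "k t" "g ?u"] kg2[OF that] by (simp add: dist_commute)
  show "fst (g t) \<in> ball (fst (g ?u)) d" if "t \<in> ?J"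
    using le(1)[of "g t" "g ?u"] gg[OF that] pos by (simp add: dist_commute)
  show 4: "norm (snd (k t) - snd (g ?u)) < \<rho> / 4" if "t \<in> ?J" for t
    using le(2)[of "k t" "g ?u"] kg2[OF that] by simp
  show "norm (snd (k t) - snd (k ?u)) < 7 / 8 * \<rho>" if "t \<in> ?J"
    using 4[OF that] 4[OF J(1)] norm_triangle_ineq4[of "snd (k t) - snd (g ?u)" "snd (k ?u) - snd (g ?u)"] pos
    by simp
  \<comment> \<open>Both \<open>q x\<close> and \<open>q (fst (k ?u))\<close>, which is
    \<open>snd (k ?u) ^ 2\<close>, are within \<open>\<rho> ^ 2 / 4\<close> of the squared base
    value, and 1/2 is less than 49/64.\<close>
  show "norm (q x - snd (k ?u) ^ 2) < (7 / 8 * \<rho>) ^ 2" if "x \<in> ball (fst (g ?u)) d"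
  proof -
    have "norm (q x - snd (k ?u) ^ 2) < \<rho> ^ 2 / 4 + \<rho> ^ 2 / 4"
      using gq[OF u that] gq[OF u 2[OF J(1)]] kg(3)[OF u]
        norm_triangle_ineq4[of "q x - snd (g ?u) ^ 2" "q (fst (k ?u)) - snd (g ?u) ^ 2"] by simp
    also have "\<dots> < (7 / 8 * \<rho>) ^ 2" using pos by (simp add: power2_eq_square)
    finally show ?thesis .
  qed
  show "branch (snd (k ?u)) (q x) = branch (snd (g ?u)) (q x)" if "x \<in> ball (fst (g ?u)) d"
    using 1 4[OF J(1)] gn[OF u] gq[OF u that] pos
    by (intro branch_recenter[of \<rho>]) (auto simp: norm_minus_commute)
  show "branch (snd (g (Suc i / N))) (q x) = branch (snd (g ?u)) (q x)"
    if "x \<in> ball (fst (g ?u)) d"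
  proof -
    have *: "norm (snd (g (Suc i / N))) \<ge> \<rho>" "norm (snd (g (Suc i / N)) - snd (g ?u)) < \<rho> / 8"
      using gn[of "Suc i / N"] J gg[OF J(2)] le(2)[of "g (Suc i / N)" "g ?u"] by auto
    show ?thesis
      using gn[OF u] gq[OF u that] pos *
      by (intro branch_recenter[of \<rho>]) (auto simp: norm_minus_commute)
  qed
qed

text \<open>The discs are centred at the original vertices, so a single family of regions serves all
  nearby curves and all shadowing paths.\<close>

lemma shadows_adapted:
  assumes m: "fine_mesh \<rho> d N g" and r: "root_region \<rho> d q g" and s: "shadows \<rho> d q g k"
  shows "adapted q k N (\<lambda>i. ball (fst (g (i / N))) d)"
  unfolding adapted_def
proof (intro conjI allI impI ballI)
  show "N > 0" using m by (simp add: fine_mesh_def)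
  have pos: "\<rho> > 0" using m by (auto simp: fine_mesh_def)
  fix i assume i: "i < N"
  note p = shadows_mesh_point[OF m r s i]
  show "norm (q x - snd (k (i / N)) ^ 2) < norm (snd (k (i / N))) ^ 2" if "x \<in> ball (fst (g (i / N))) d" for x
  proof -
    have "(7 / 8 * \<rho>) ^ 2 \<le> norm (snd (k (i / N))) ^ 2"
      using p(1) pos by (intro power_mono) auto
    then show ?thesis using p(6)[OF that] by linarith
  qed
  fix t assume t: "t \<in> {i / N..Suc i / N}"
  show "fst (k t) \<in> ball (fst (g (i / N))) d" using p(2)[OF t] .
  show "norm (snd (k t) - snd (k (i / N))) < norm (snd (k (i / N)))"
    using p(5)[OF t] p(1) by simp
  have "t \<in> {0..1}" using mesh_interval_subset[OF i] t by blast
  then show "snd (k t) ^ 2 = q (fst (k t))" using s by (simp add: shadows_def)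
qed auto

section \<open>Cycles representing a homology class, and a common mesh for their edges\<close>

lemma homology_class_cycle:
  assumes "\<gamma> \<in> carrier (homology_group 1 X)" "z \<in> \<gamma>"
  shows "singular_chain 1 X z" "chain_boundary 1 z = 0"
proof -
  have "\<gamma> \<in> homologous_rel_set 1 X {} ` singular_relcycle_set 1 X {}"
    using assms(1) carrier_relative_homology_group[of 1 X "{}"] by simp
  then obtain c where c: "singular_relcycle 1 X {} c" "homologous_rel 1 X {} c z"
    using assms(2) by auto
  \<comment> \<open>Now \<open>z\<close> is \<open>c - (c - z)\<close>, a cycle minus a
    boundary.\<close>
  then have "singular_relcycle 1 X {} (c - z)"
    by (simp add: homologous_rel_def singular_relboundary_imp_relcycle)
  from singular_relcycle_diff[OF c(1) this] have "singular_relcycle 1 X {} z" by simp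
  then show "singular_chain 1 X z" "chain_boundary 1 z = 0"
    by (auto simp only: singular_cycle)
qed

lemma singular_chain_edge_path:
  assumes "singular_chain 1 (top_of_set S) z" "\<sigma> \<in> Poly_Mapping.keys z" "t \<in> {0..1}"
  shows "edge_path \<sigma> t \<in> S"
proof -
  have "continuous_map (subtopology (powertop_real UNIV) (standard_simplex 1)) (top_of_set S) \<sigma>"
    using assms by (auto simp: singular_chain_def singular_simplex_def)
  then have "\<sigma> ` standard_simplex 1 \<subseteq> S"
    using continuous_map_image_subset_topspace by fastforce
  then show ?thesis using assms(3) by (auto simp: edge_path_eq standard_simplex_1 simp del: One_nat_def)
qed

text \<open>A chain has finitely many edges, so its support is compact and one choice of
  \<open>\<rho>\<close>, \<open>d\<close> and \<open>N\<close> works for all edges and for all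
  parameters near \<open>(a, b)\<close>.\<close>

lemma admissible_fine_mesh:
  assumes z: "admissible z" "\<And>\<sigma> t. \<sigma> \<in> Poly_Mapping.keys z \<Longrightarrow> t \<in> {0..1} \<Longrightarrow> edge_path \<sigma> t \<in> E a b"
  obtains \<rho> d N where "\<rho> > 0" "d > 0"
    "\<And>\<sigma>. \<sigma> \<in> Poly_Mapping.keys z \<Longrightarrow> fine_mesh \<rho> d N (edge_path \<sigma>)"
    "\<And>\<sigma> s t. \<sigma> \<in> Poly_Mapping.keys z \<Longrightarrow> dist (s, t) (a, b) < d \<Longrightarrow> root_region \<rho> d (Q s t) (edge_path \<sigma>)"
proof -
  have cont: "continuous_on {0..1} (edge_path \<sigma>)" if "\<sigma> \<in> Poly_Mapping.keys z" for \<sigma>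
    using z(1) that by (auto simp: admissible_def valid_path_def piecewise_C1_differentiable_on_def)
  have "compact (chain_support z)"
    unfolding chain_support_eq by (intro compact_UN finite_keys compact_continuous_image cont) auto
  moreover have "chain_support z \<subseteq> E a b"
    using z(2) by (auto simp: chain_support_eq)
  moreover have "snd p \<noteq> 0" if "p \<in> chain_support z" for p
    using that z(1) by (auto simp: chain_support_eq admissible_def)
  ultimately obtain \<rho> d where rd: "\<rho> > 0" "d > 0" "\<And>p. p \<in> chain_support z \<Longrightarrow> \<rho> \<le> norm (snd p)"
    "\<And>p s t x. p \<in> chain_support z \<Longrightarrow> dist (s, t) (a, b) < d \<Longrightarrow> norm (x - fst p) < d \<Longrightarrow>
       norm (Q s t x - snd p ^ 2) < \<rho> ^ 2 / 4"
    using Q_near_compact by blast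
  let ?G = "edge_path ` Poly_Mapping.keys z"
  have "finite ?G" "min (d / 2) (\<rho> / 8) > 0" "\<And>g. g \<in> ?G \<Longrightarrow> continuous_on {0..1} g"
    using rd cont by auto
  then obtain N :: nat where N: "N > 0" "\<And>g i t. g \<in> ?G \<Longrightarrow> i < N \<Longrightarrow> t \<in> {i / N..Suc i / N} \<Longrightarrow>
      dist (g t) (g (i / N)) < min (d / 2) (\<rho> / 8)"
    using fine_partition by blast
  have supp: "edge_path \<sigma> t \<in> chain_support z" if "\<sigma> \<in> Poly_Mapping.keys z" "t \<in> {0..1}" for \<sigma> t
    using that unfolding chain_support_eq by blast
  show ?thesis
  proof (rule that[OF rd(1,2)])
    fix \<sigma> assume \<sigma>: "\<sigma> \<in> Poly_Mapping.keys z"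
    show "fine_mesh \<rho> d N (edge_path \<sigma>)"
      unfolding fine_mesh_def using rd(1,2) N rd(3)[OF supp[OF \<sigma>]] \<sigma> by blast
    show "root_region \<rho> d (Q s t) (edge_path \<sigma>)" if "dist (s, t) (a, b) < d" for s t
      unfolding root_region_def using rd(4)[OF supp[OF \<sigma>] that]
      by (auto simp: dist_norm norm_minus_commute)
  qed
qed

subsection \<open>The exact form\<close>

lemma has_field_derivative_Q: "(Q a b has_field_derivative 3 * x ^ 2 + a) (at x within S)"
  unfolding Q_def by (auto intro!: derivative_eq_intros)

lemma deriv_Q: "deriv (Q a b) = (\<lambda>x. 3 * x ^ 2 + a)"
  by (rule ext, rule DERIV_imp_deriv, rule has_field_derivative_Q)

lemma deriv_deriv_Q: "deriv (deriv (Q a b)) x = 6 * x"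
  unfolding deriv_Q by (rule DERIV_imp_deriv) (auto intro!: derivative_eq_intros)

lemma has_field_derivative_branch_Q:
  assumes "norm (Q a b x - c ^ 2) < norm c ^ 2"
  shows "((\<lambda>x. branch c (Q a b x)) has_field_derivative (3 * x ^ 2 + a) / (2 * branch c (Q a b x))) (at x)"
  using has_field_derivative_branch[OF assms has_field_derivative_Q] .

lemma branch_Q_differentiable:
  "norm (Q a b x - c ^ 2) < norm c ^ 2 \<Longrightarrow> (\<lambda>x. branch c (Q a b x)) field_differentiable at x"
  using has_field_derivative_branch_Q field_differentiable_def by blast

text \<open>The polynomial in the primitive solves
  \<open>P' Q - P Q' / 2 = x / 8 - (a\<^sup>2 / (4 \<Delta>) - 9 b x / (8 \<Delta>)) Q\<close>; the first summand reduces the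
  form of \<open>Z\<^sub>2\<close> to \<open>x / (8 y\<^sup>3) dx\<close>.\<close>

definition Z2_primitive :: "complex \<Rightarrow> complex \<Rightarrow> complex \<times> complex \<Rightarrow> complex" where
  "Z2_primitive a b = (\<lambda>(x, y). 5 / 48 * (3 * x ^ 2 + a) / y ^ 3 +
     (9 * b / 4 * x ^ 2 + a ^ 2 / 2 * x + 3 * a * b / 2) / (Disc a b * y))"

definition Z2_remainder :: "complex \<Rightarrow> complex \<Rightarrow> complex \<times> complex \<Rightarrow> complex" where
  "Z2_remainder a b = (\<lambda>(x, y). 6 * x / (8 * y ^ 3) - 5 * (3 * x ^ 2 + a) ^ 2 / (32 * y ^ 5)
     - a ^ 2 / (4 * Disc a b) * (1 / y) - (- (9 * b / (8 * Disc a b))) * (x / y))"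

text \<open>The left side is the derivative of \<open>Z2_primitive\<close> along the curve, using
  \<open>y' = Q' / (2 * y)\<close>. Clearing denominators in its second summand leaves a polynomial
  identity in \<open>x\<close>, namely the equation for \<open>P\<close> multiplied by
  \<open>D\<close>.\<close>

lemma Z2_reduction_identity:
  fixes a b x y D :: complex
  assumes D: "D = Disc a b" "D \<noteq> 0" and y: "y ^ 2 = Q a b x" "y \<noteq> 0"
  shows "5 / 48 * (6 * x / y ^ 3 - 3 * (3 * x ^ 2 + a) ^ 2 / (2 * y ^ 5)) +
     ((9 * b / 2 * x + a ^ 2 / 2) / (D * y)
       - (9 * b / 4 * x ^ 2 + a ^ 2 / 2 * x + 3 * a * b / 2) * (3 * x ^ 2 + a) / (2 * D * y ^ 3)) =
     6 * x / (8 * y ^ 3) - 5 * (3 * x ^ 2 + a) ^ 2 / (32 * y ^ 5)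
     - a ^ 2 / (4 * D) * (1 / y) - (- (9 * b / (8 * D))) * (x / y)"
proof -
  have "x / 8 * D - (a ^ 2 / 4 - 9 * b / 8 * x) * Q a b x =
    (9 * b / 2 * x + a ^ 2 / 2) * Q a b x
      - (9 * b / 4 * x ^ 2 + a ^ 2 / 2 * x + 3 * a * b / 2) * (3 * x ^ 2 + a) / 2"
    unfolding D(1) Q_def Disc_def by (simp add: field_simps power2_eq_square power3_eq_cube)
  then have *: "x / 8 * D - (a ^ 2 / 4 - 9 * b / 8 * x) * y ^ 2 =
    (9 * b / 2 * x + a ^ 2 / 2) * y ^ 2
      - (9 * b / 4 * x ^ 2 + a ^ 2 / 2 * x + 3 * a * b / 2) * (3 * x ^ 2 + a) / 2"
    by (simp only: y(1))
  have "x / (8 * y ^ 3) - (a ^ 2 / (4 * D) * (1 / y) + (- (9 * b / (8 * D))) * (x / y)) =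
    (x / 8 * D - (a ^ 2 / 4 - 9 * b / 8 * x) * y ^ 2) / (D * y ^ 3)"
    using D(2) y(2) by (simp add: field_simps power2_eq_square power3_eq_cube)
  also have "\<dots> = (9 * b / 2 * x + a ^ 2 / 2) / (D * y)
       - (9 * b / 4 * x ^ 2 + a ^ 2 / 2 * x + 3 * a * b / 2) * (3 * x ^ 2 + a) / (2 * D * y ^ 3)"
    unfolding * using D(2) y(2) by (simp add: field_simps power2_eq_square power3_eq_cube)
  finally have **: "(9 * b / 2 * x + a ^ 2 / 2) / (D * y)
       - (9 * b / 4 * x ^ 2 + a ^ 2 / 2 * x + 3 * a * b / 2) * (3 * x ^ 2 + a) / (2 * D * y ^ 3) =
     x / (8 * y ^ 3) - (a ^ 2 / (4 * D) * (1 / y) + (- (9 * b / (8 * D))) * (x / y))" ..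
  \<comment> \<open>The factor 5/48 is chosen to match the \<open>y ^ 5\<close> terms; the
    \<open>y ^ 3\<close> terms then differ by exactly \<open>x / (8 * y ^ 3)\<close>.\<close>
  have ***: "5 / 48 * (6 * x / y ^ 3 - 3 * S / (2 * y ^ 5)) = 6 * x / (8 * y ^ 3) - x / (8 * y ^ 3) - 5 * S / (32 * y ^ 5)" for S
    by simp
  have "u - v - w + (v - (p + q)) = u - w - p - q" for u v w p q :: complex
    by simp
  then show ?thesis unfolding ** *** .
qed

lemma Z2_primitive_derivative:
  assumes D: "Disc a b \<noteq> 0" and c: "norm (Q a b x - c ^ 2) < norm c ^ 2"
  shows "((\<lambda>x. Z2_primitive a b (x, branch c (Q a b x))) has_field_derivative
     Z2_remainder a b (x, branch c (Q a b x))) (at x)"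
proof -
  let ?y = "branch c (Q a b x)"
  have y: "?y \<noteq> 0" "?y ^ 2 = Q a b x"
    using branch_nonzero[OF c] c by (auto intro: branch_power2)
  let ?y' = "(3 * x ^ 2 + a) / (2 * ?y)"
  let ?P = "\<lambda>x. 9 * b / 4 * x ^ 2 + a ^ 2 / 2 * x + 3 * a * b / 2"
  note dy = has_field_derivative_branch_Q[OF c]
  have 1: "((\<lambda>x. 5 / 48 * (3 * x ^ 2 + a) / branch c (Q a b x) ^ 3) has_field_derivative
      (5 / 48 * (6 * x) * ?y ^ 3 - 5 / 48 * (3 * x ^ 2 + a) * (3 * ?y ^ 2 * ?y')) / (?y ^ 3 * ?y ^ 3)) (at x)"
    by (rule DERIV_divide) (use y dy in \<open>auto intro!: derivative_eq_intros\<close>)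
  have 2: "((\<lambda>x. ?P x / (Disc a b * branch c (Q a b x))) has_field_derivative
      ((9 * b / 2 * x + a ^ 2 / 2) * (Disc a b * ?y) - ?P x * (Disc a b * ?y')) /
      ((Disc a b * ?y) * (Disc a b * ?y))) (at x)"
    by (rule DERIV_divide) (use y dy D in \<open>auto intro!: derivative_eq_intros\<close>)
  \<comment> \<open>Cancelling powers of \<open>y\<close> brings the two quotient-rule derivatives
    into the shape of \<open>Z2_reduction_identity\<close>.\<close>
  have e1: "(5 / 48 * (6 * x) * ?y ^ 3 - 5 / 48 * (3 * x ^ 2 + a) * (3 * ?y ^ 2 * ?y')) / (?y ^ 3 * ?y ^ 3)
      = 5 / 48 * (6 * x / ?y ^ 3 - 3 * (3 * x ^ 2 + a) ^ 2 / (2 * ?y ^ 5))"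
    using y(1) by (simp add: divide_simps) (simp add: algebra_simps power_numeral_reduce)
  have e2: "((9 * b / 2 * x + a ^ 2 / 2) * (Disc a b * ?y) - ?P x * (Disc a b * ?y')) /
      ((Disc a b * ?y) * (Disc a b * ?y)) =
     (9 * b / 2 * x + a ^ 2 / 2) / (Disc a b * ?y) - ?P x * (3 * x ^ 2 + a) / (2 * Disc a b * ?y ^ 3)"
    using y(1) D by (simp add: divide_simps) (simp add: algebra_simps power_numeral_reduce)
  show ?thesis
    using DERIV_add[OF 1 2] Z2_reduction_identity[OF refl D y(2,1)]
    unfolding e1 e2 by (simp add: Z2_primitive_def Z2_remainder_def)
qed

text \<open>Since \<open>integral\<close> is total, \<open>integral_dx\<close> alone does not
  guarantee integrability; the polygon evaluation does, so these integrals may be added.\<close>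

lemma edge_integrand_has_integral_dx:
  assumes "valid_path g" "adapted (Q a b) g N D"
    and "\<And>c x. norm (Q a b x - c ^ 2) < norm c ^ 2 \<Longrightarrow>
       (\<lambda>x. f (x, branch c (Q a b x))) field_differentiable (at x)"
  shows "(edge_integrand f g has_integral integral_dx f g) {0..1}"
  unfolding integral_dx_eq
  using edge_integrand_has_integral_polygon[OF assms] by (rule integrable_integral[OF has_integral_integrable])

text \<open>The integrand splits into the two periods and the exact form
  \<open>Z2_remainder\<close>, which contributes only the endpoint values of its primitive.\<close>

lemma Z2_edge:
  assumes D: "Disc a b \<noteq> 0" and g: "valid_path g" "adapted (Q a b) g N S"
  shows "integral_dx (\<lambda>(x, y). 6 * x / (8 * y ^ 3) - 5 * (3 * x ^ 2 + a) ^ 2 / (32 * y ^ 5)) g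
    = a ^ 2 / (4 * Disc a b) * integral_dx (\<lambda>(x, y). 1 / y) g
      + - (9 * b / (8 * Disc a b)) * integral_dx (\<lambda>(x, y). x / y) g
      + (Z2_primitive a b (g 1) - Z2_primitive a b (g 0))" (is "?Z = ?R")
proof -
  have A: "(edge_integrand (\<lambda>(x, y). 1 / y) g has_integral integral_dx (\<lambda>(x, y). 1 / y) g) {0..1}"
    using branch_Q_differentiable branch_nonzero
    by (intro edge_integrand_has_integral_dx[OF g]) (auto intro!: derivative_intros)
  have B: "(edge_integrand (\<lambda>(x, y). x / y) g has_integral integral_dx (\<lambda>(x, y). x / y) g) {0..1}"
    using branch_Q_differentiable branch_nonzero
    by (intro edge_integrand_has_integral_dx[OF g]) (auto intro!: derivative_intros)
  have C: "(edge_integrand (Z2_remainder a b) g has_integral Z2_primitive a b (g 1) - Z2_primitive a b (g 0)) {0..1}"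
    by (rule edge_integrand_has_integral_exact[OF g]) (rule Z2_primitive_derivative[OF D])
  have eq: "edge_integrand (\<lambda>(x, y). 6 * x / (8 * y ^ 3) - 5 * (3 * x ^ 2 + a) ^ 2 / (32 * y ^ 5)) g =
    (\<lambda>t. a ^ 2 / (4 * Disc a b) * edge_integrand (\<lambda>(x, y). 1 / y) g t
      + - (9 * b / (8 * Disc a b)) * edge_integrand (\<lambda>(x, y). x / y) g t + edge_integrand (Z2_remainder a b) g t)"
    by (auto simp: fun_eq_iff edge_integrand_def Z2_remainder_def split_beta algebra_simps)
  have "(edge_integrand (\<lambda>(x, y). 6 * x / (8 * y ^ 3) - 5 * (3 * x ^ 2 + a) ^ 2 / (32 * y ^ 5)) g
      has_integral ?R) {0..1}"
    unfolding eq by (intro has_integral_add has_integral_mult_right A B C)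
  then show ?thesis by (simp add: integral_dx_eq integral_unique)
qed

text \<open>Lets \<open>shadows_adapted\<close> produce meshes for the original cycle as
  well.\<close>

lemma shadows_self:
  assumes "\<rho> > 0" "d > 0" "\<And>t. t \<in> {0..1} \<Longrightarrow> g t \<in> E a b"
  shows "shadows \<rho> d (Q a b) g g"
  using assms by (force simp: shadows_def E_def)

lemma Z2_eq_A_B:
  assumes D: "Disc a b \<noteq> 0" and z: "singular_chain 1 (top_of_set (E a b)) z" "chain_boundary 1 z = 0" "admissible z"
  shows "Z2 a b z = a ^ 2 / (4 * Disc a b) * A z - 9 * b / (8 * Disc a b) * B z"
proof -
  note on_E = singular_chain_edge_path[OF z(1)]
  obtain \<rho> d N where m: "\<rho> > 0" "d > 0"
    "\<And>\<sigma>. \<sigma> \<in> Poly_Mapping.keys z \<Longrightarrow> fine_mesh \<rho> d N (edge_path \<sigma>)"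
    "\<And>\<sigma> s t. \<sigma> \<in> Poly_Mapping.keys z \<Longrightarrow> dist (s, t) (a, b) < d \<Longrightarrow> root_region \<rho> d (Q s t) (edge_path \<sigma>)"
    using admissible_fine_mesh[OF z(3) on_E] by blast
  let ?h = "Z2_primitive a b"
  have "Z2 a b z = weight_sum (\<lambda>\<sigma>. a ^ 2 / (4 * Disc a b) * integral_dx (\<lambda>(x, y). 1 / y) (edge_path \<sigma>)
      + - (9 * b / (8 * Disc a b)) * integral_dx (\<lambda>(x, y). x / y) (edge_path \<sigma>)
      + (?h (edge_path \<sigma> 1) - ?h (edge_path \<sigma> 0))) z"
    unfolding Z2_def chain_integral_dx_eq deriv_deriv_Q unfolding deriv_Q
  proof (rule weight_sum_cong)
    fix \<sigma> assume \<sigma>: "\<sigma> \<in> Poly_Mapping.keys z"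
    have "adapted (Q a b) (edge_path \<sigma>) N (\<lambda>i. ball (fst (edge_path \<sigma> (i / N))) d)"
      using m \<sigma> on_E[OF \<sigma>] by (intro shadows_adapted shadows_self) auto
    then show "integral_dx (\<lambda>(x, y). 6 * x / (8 * y ^ 3) - 5 * (3 * x ^ 2 + a) ^ 2 / (32 * y ^ 5)) (edge_path \<sigma>)
      = a ^ 2 / (4 * Disc a b) * integral_dx (\<lambda>(x, y). 1 / y) (edge_path \<sigma>)
      + - (9 * b / (8 * Disc a b)) * integral_dx (\<lambda>(x, y). x / y) (edge_path \<sigma>)
      + (?h (edge_path \<sigma> 1) - ?h (edge_path \<sigma> 0))"
      using z(3) \<sigma> by (intro Z2_edge[OF D]) (auto simp: admissible_def)
  qed
  also have "\<dots> = a ^ 2 / (4 * Disc a b) * A z + - (9 * b / (8 * Disc a b)) * B z + 0"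
    by (simp only: weight_sum_add_fun weight_sum_cmult_fun weight_sum_boundary[OF z(2)]
        A_def B_def chain_integral_dx_eq)
  finally show ?thesis by simp
qed

subsection \<open>Variation of the period\<close>

text \<open>The integral of \<open>y dx\<close> along the short segment from a vertex to its moved
  position. For a fixed \<open>q\<close> it depends on the two points only, which makes it a
  function of vertices.\<close>

definition root_transport :: "(complex \<Rightarrow> complex) \<Rightarrow> complex \<times> complex \<Rightarrow> complex \<times> complex \<Rightarrow> complex" where
  "root_transport q p p' = contour_integral (linepath (fst p) (fst p')) (\<lambda>x. branch (snd p) (q x))"

text \<open>Corresponding sides of the two polygons and the segments joining their ends bound a
  quadrilateral inside one disc, where a single branch has a primitive. Its integral vanishes, and
  the joining segments telescope along the edge.\<close>

lemma polygon_integral_shadow: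
  assumes m: "fine_mesh \<rho> d N g" and r: "root_region \<rho> d q g" and s: "shadows \<rho> d q g k"
    and q: "\<And>x. q field_differentiable at x"
  shows "polygon_integral (\<lambda>(x, y). y) q N k = polygon_integral (\<lambda>(x, y). y) q N g +
     (root_transport q (g 1) (k 1) - root_transport q (g 0) (k 0))"
proof -
  let ?H = "\<lambda>i. root_transport q (g (i / N)) (k (i / N))"
  let ?J = "\<lambda>k i. contour_integral (linepath (fst (k (i / N))) (fst (k (Suc i / N))))
     (\<lambda>x. branch (snd (k (i / N))) (q x))"
  have "?J k i = ?J g i + (?H (Suc i) - ?H i)" if i: "i < N" for i :: nat
  proof -
    note p = shadows_mesh_point[OF m r s i]
    let ?D = "ball (fst (g (i / N))) d" and ?h = "\<lambda>x. branch (snd (g (i / N))) (q x)"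
    have ends: "i / N \<in> {i / N..Suc i / N}" "Suc i / N \<in> {i / N..Suc i / N}"
      by (auto simp: divide_simps)
    have "?h field_differentiable at x within ?D" if "x \<in> ?D" for x
    proof -
      have t: "i / N \<in> {0..1::real}" using i by (simp add: divide_simps)
      then have "\<rho> \<le> norm (snd (g (i / N)))" "0 < \<rho>" using m by (auto simp: fine_mesh_def)
      then have "\<rho> ^ 2 / 4 < norm (snd (g (i / N))) ^ 2"
        using power_mono[of \<rho> "norm (snd (g (i / N)))" 2] zero_less_power[of \<rho> 2] by linarith
      moreover have "norm (q x - snd (g (i / N)) ^ 2) < \<rho> ^ 2 / 4"
        using r t that by (auto simp: root_region_def)
      ultimately have "norm (q x - snd (g (i / N)) ^ 2) < norm (snd (g (i / N))) ^ 2" by linarith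
      moreover obtain q' where "(q has_field_derivative q') (at x)"
        using q field_differentiable_def by blast
      ultimately show ?thesis
        using has_field_derivative_branch field_differentiable_def field_differentiable_at_within by blast
    qed
    then have "?h holomorphic_on ?D" by (simp add: holomorphic_on_def)
    then obtain G where G: "\<And>x. x \<in> ?D \<Longrightarrow> (G has_field_derivative ?h x) (at x within ?D)"
      using holomorphic_convex_primitive'[of ?D ?h] by auto
    have seg: "contour_integral (linepath u v) f = G v - G u"
      if "u \<in> ?D" "v \<in> ?D" "\<And>x. x \<in> ?D \<Longrightarrow> f x = ?h x" for u v f
      using that G by (intro contour_integral_linepath_primitive[where D = ?D]) auto
    have "?J k i = G (fst (k (Suc i / N))) - G (fst (k (i / N)))"
      by (rule seg[OF p(2)[OF ends(1)] p(2)[OF ends(2)] p(7)])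
    moreover have "?J g i = G (fst (g (Suc i / N))) - G (fst (g (i / N)))"
      by (rule seg[OF p(3)[OF ends(1)] p(3)[OF ends(2)] refl])
    moreover have "?H i = G (fst (k (i / N))) - G (fst (g (i / N)))"
      unfolding root_transport_def by (rule seg[OF p(3)[OF ends(1)] p(2)[OF ends(1)] refl])
    \<comment> \<open>Here the transport uses the branch of the next vertex, which agrees on this
      disc with the branch of the current one.\<close>
    moreover have "?H (Suc i) = G (fst (k (Suc i / N))) - G (fst (g (Suc i / N)))"
      unfolding root_transport_def by (rule seg[OF p(3)[OF ends(2)] p(2)[OF ends(2)] p(8)])
    ultimately show ?thesis by simp
  qed
  then have "polygon_integral (\<lambda>(x, y). y) q N k = (\<Sum>i<N. ?J g i + (?H (Suc i) - ?H i))"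
    unfolding polygon_integral_def by (intro sum.cong) auto
  also have "\<dots> = polygon_integral (\<lambda>(x, y). y) q N g + (?H N - ?H 0)"
    by (simp only: sum.distrib sum_lessThan_telescope[of ?H N] polygon_integral_def prod.case of_nat_0)
  finally show ?thesis using m by (simp add: fine_mesh_def)
qed

text \<open>Differentiation under the integral sign: the segment and the branch centre
  \<open>c\<close> do not move, and the root of \<open>Q\<close> has derivative
  \<open>(\<alpha> * x + \<beta>) / (2 * y)\<close> in \<open>h\<close>.\<close>

lemma contour_integral_linepath_root_derivative:
  assumes "e > 0"
    and near: "\<And>h x :: complex. h \<in> ball 0 e \<Longrightarrow> x \<in> closed_segment u v \<Longrightarrow>
       norm (Q (a + h * \<alpha>) (b + h * \<beta>) x - c ^ 2) < norm c ^ 2"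
  shows "((\<lambda>h. contour_integral (linepath u v) (\<lambda>x. branch c (Q (a + h * \<alpha>) (b + h * \<beta>) x)))
     has_field_derivative contour_integral (linepath u v) (\<lambda>x. (\<alpha> * x + \<beta>) / (2 * branch c (Q a b x)))) (at 0)"
proof -
  let ?X = "linepath u v" and ?q = "\<lambda>h x. Q (a + h * \<alpha>) (b + h * \<beta>) x"
  have X: "?X t \<in> closed_segment u v" if "t \<in> {0..1}" for t
    using that by (auto simp flip: linepath_image_01)
  have nz: "branch c (?q h (?X t)) \<noteq> 0" if "h \<in> ball 0 e" "t \<in> {0..1}" for h :: complex and t
    by (rule branch_nonzero[OF near[OF that(1) X[OF that(2)]]])
  have contX: "continuous_on T (\<lambda>p. ?X (f p))" if "continuous_on T f" for f :: "'z::topological_space \<Rightarrow> real" and T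
    using that unfolding linepath_def by (intro continuous_intros)
  have "((\<lambda>h. integral (cbox 0 1) (\<lambda>t. branch c (?q h (?X t)) * (v - u))) has_field_derivative
     integral (cbox 0 1) (\<lambda>t. (\<alpha> * ?X t + \<beta>) / (2 * branch c (?q 0 (?X t))) * (v - u))) (at 0 within ball 0 e)"
  proof (rule leibniz_rule_field_derivative)
    fix h :: complex and t :: real assume h: "h \<in> ball 0 e" and t: "t \<in> cbox 0 1"
    have "((\<lambda>h. ?q h (?X t)) has_field_derivative \<alpha> * ?X t + \<beta>) (at h within ball 0 e)"
      unfolding Q_def by (auto intro!: derivative_eq_intros)
    from has_field_derivative_branch[OF near[OF h X] this]
    show "((\<lambda>h. branch c (?q h (?X t)) * (v - u)) has_field_derivative
      (\<alpha> * ?X t + \<beta>) / (2 * branch c (?q h (?X t))) * (v - u)) (at h within ball 0 e)"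
      using t by (intro DERIV_cmult_right) auto
  next
    fix h :: complex assume h: "h \<in> ball 0 e"
    have "continuous_on (cbox 0 1) (\<lambda>t. branch c (?q h (?X t)) * (v - u))"
      using near[OF h X] by (intro continuous_intros) (auto simp: Q_def intro!: continuous_intros contX)
    then show "(\<lambda>t. branch c (?q h (?X t)) * (v - u)) integrable_on cbox 0 1"
      by (rule integrable_continuous)
  next
    have "continuous_on (ball 0 e \<times> {0..1}) (\<lambda>p. branch c (?q (fst p) (?X (snd p))))"
    proof (rule continuous_on_branch)
      show "continuous_on (ball 0 e \<times> {0..1}) (\<lambda>p. ?q (fst p) (?X (snd p)))"
        unfolding Q_def by (intro continuous_intros contX)
    qed (use near X in auto)
    then show "continuous_on (ball 0 e \<times> cbox 0 1)
        (\<lambda>(h, t). (\<alpha> * ?X t + \<beta>) / (2 * branch c (?q h (?X t))) * (v - u))"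
      using nz by (auto simp: split_beta intro!: continuous_intros contX)
  qed (use \<open>e > 0\<close> in auto)
  then show ?thesis
    using \<open>e > 0\<close> by (simp add: contour_integral_integral at_within_open[of 0 "ball 0 e"])
qed

text \<open>Each side lies in the disc about its initial vertex, so \<open>root_region\<close> keeps
  the root away from its cut for all small \<open>h\<close>, and the polygon can be differentiated
  side by side.\<close>

lemma polygon_integral_root_derivative:
  assumes m: "fine_mesh \<rho> d N g" and "e > 0"
    and r: "\<And>h. h \<in> ball 0 e \<Longrightarrow> root_region \<rho> d (Q (a + h * \<alpha>) (b + h * \<beta>)) g"
  shows "((\<lambda>h. polygon_integral (\<lambda>(x, y). y) (Q (a + h * \<alpha>) (b + h * \<beta>)) N g) has_field_derivative
     polygon_integral (\<lambda>(x, y). (\<alpha> * x + \<beta>) / (2 * y)) (Q a b) N g) (at 0)"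
  unfolding polygon_integral_def prod.case
proof (intro DERIV_sum contour_integral_linepath_root_derivative)
  fix i and h x :: complex assume i: "i \<in> {..<N}" and h: "h \<in> ball 0 e"
    and x: "x \<in> closed_segment (fst (g (real i / real N))) (fst (g (real (Suc i) / real N)))"
  let ?D = "ball (fst (g (i / N))) d"
  have t: "i / N \<in> {0..1::real}" "Suc i / N \<in> {real i / N..Suc i / N}" using i by (auto simp: divide_simps)
  have \<rho>: "\<rho> \<le> norm (snd (g (i / N)))" "0 < \<rho>" "0 < d" using m t by (auto simp: fine_mesh_def)
  have "dist (g (Suc i / N)) (g (i / N)) < d / 2" using m t i unfolding fine_mesh_def by auto
  then have "fst (g (Suc i / N)) \<in> ?D"
    using dist_fst_le[of "g (Suc i / N)" "g (i / N)"] \<rho> by (simp add: dist_commute)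
  then have "closed_segment (fst (g (i / N))) (fst (g (Suc i / N))) \<subseteq> ?D"
    using \<rho> by (intro closed_segment_subset) auto
  with x have "x \<in> ?D" by blast
  then have "norm (Q (a + h * \<alpha>) (b + h * \<beta>) x - snd (g (i / N)) ^ 2) < \<rho> ^ 2 / 4"
    using r[OF h] t(1) by (auto simp: root_region_def)
  moreover have "\<rho> ^ 2 / 4 < norm (snd (g (i / N))) ^ 2"
    using power_mono[OF \<rho>(1), of 2] zero_less_power[OF \<rho>(2), of 2] \<rho>(2) by linarith
  ultimately show "norm (Q (a + h * \<alpha>) (b + h * \<beta>) x - snd (g (i / N)) ^ 2) < norm (snd (g (i / N))) ^ 2"
    by linarith
qed (rule \<open>e > 0\<close>)

lemma weight_sum_has_field_derivative:
  assumes "\<And>k. k \<in> Poly_Mapping.keys c \<Longrightarrow> ((\<lambda>h. f h k) has_field_derivative f' k) (at x)"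
  shows "((\<lambda>h. weight_sum (f h) c) has_field_derivative weight_sum f' c) (at x)"
  unfolding weight_sum_def using assms by (intro DERIV_sum DERIV_cmult) auto

lemma keys_chain_map: "Poly_Mapping.keys (chain_map p f z) \<subseteq> simplex_map p f ` Poly_Mapping.keys z"
  using keys_frag_extend[of "frag_of \<circ> simplex_map p f" z] by (auto simp: chain_map_def keys_frag_of)

text \<open>Edges of \<open>z\<close> whose images cancel in the push-forward may have images that are not piecewise
  smooth. Hence the polygonal integral, which makes sense for any image, is introduced before the
  sum over the push-forward is written as a sum over \<open>z\<close>.\<close>

lemma Z0_chain_map:
  assumes z: "singular_chain 1 (top_of_set (E a b)) z" "chain_boundary 1 z = 0"
    and m: "\<And>\<sigma>. \<sigma> \<in> Poly_Mapping.keys z \<Longrightarrow> fine_mesh \<rho> d N (edge_path \<sigma>)"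
    and r: "\<And>\<sigma>. \<sigma> \<in> Poly_Mapping.keys z \<Longrightarrow> root_region \<rho> d (Q s t) (edge_path \<sigma>)"
    and \<phi>: "\<And>p. p \<in> chain_support z \<Longrightarrow> dist (\<phi> p) p < min (d / 2) (\<rho> / 8)"
      "\<phi> ` chain_support z \<subseteq> E s t"
    and adm: "admissible (chain_map 1 \<phi> z)"
  shows "Z0 (chain_map 1 \<phi> z) = weight_sum (\<lambda>\<sigma>. polygon_integral (\<lambda>(x, y). y) (Q s t) N (edge_path \<sigma>)) z"
proof -
  let ?k = "\<lambda>\<sigma>. edge_path (simplex_map 1 \<phi> \<sigma>)" and ?f = "\<lambda>(x::complex, y::complex). y"
  have k: "?k \<sigma> u = \<phi> (edge_path \<sigma> u)" if "u \<in> {0..1}" for \<sigma> u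
    using edge_path_simplex_map[OF that] .
  have shadow: "shadows \<rho> d (Q s t) (edge_path \<sigma>) (?k \<sigma>)" if \<sigma>: "\<sigma> \<in> Poly_Mapping.keys z" for \<sigma>
    unfolding shadows_def
  proof (intro ballI)
    fix u :: real assume u: "u \<in> {0..1}"
    have p: "edge_path \<sigma> u \<in> chain_support z"
      using \<sigma> u unfolding chain_support_eq by blast
    then have "\<phi> (edge_path \<sigma> u) \<in> E s t" using \<phi>(2) by blast
    then show "dist (?k \<sigma> u) (edge_path \<sigma> u) < min (d / 2) (\<rho> / 8) \<and> snd (?k \<sigma> u) ^ 2 = Q s t (fst (?k \<sigma> u))"
      using \<phi>(1)[OF p] unfolding k[OF u] by (auto simp: E_def)
  qed
  have "Z0 (chain_map 1 \<phi> z) = weight_sum (\<lambda>\<tau>. polygon_integral ?f (Q s t) N (edge_path \<tau>)) (chain_map 1 \<phi> z)"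
    unfolding Z0_def chain_integral_dx_eq
  proof (rule weight_sum_cong)
    fix \<tau> assume \<tau>: "\<tau> \<in> Poly_Mapping.keys (chain_map 1 \<phi> z)"
    then obtain \<sigma> where \<sigma>: "\<sigma> \<in> Poly_Mapping.keys z" "\<tau> = simplex_map 1 \<phi> \<sigma>"
      using keys_chain_map by blast
    have "valid_path (edge_path \<tau>)" using adm \<tau> by (simp add: admissible_def)
    moreover have "adapted (Q s t) (edge_path \<tau>) N (\<lambda>i. ball (fst (edge_path \<sigma> (i / N))) d)"
      unfolding \<sigma>(2) by (rule shadows_adapted[OF m r shadow]) (rule \<sigma>(1))+
    ultimately have "(edge_integrand ?f (edge_path \<tau>) has_integral polygon_integral ?f (Q s t) N (edge_path \<tau>)) {0..1}"
      by (rule edge_integrand_has_integral_polygon) (auto intro: branch_Q_differentiable)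
    then show "integral_dx ?f (edge_path \<tau>) = polygon_integral ?f (Q s t) N (edge_path \<tau>)"
      by (simp add: integral_dx_eq integral_unique)
  qed
  also have "\<dots> = weight_sum (\<lambda>\<sigma>. polygon_integral ?f (Q s t) N (?k \<sigma>)) z"
    by (rule weight_sum_chain_map)
  also have "\<dots> = weight_sum (\<lambda>\<sigma>. polygon_integral ?f (Q s t) N (edge_path \<sigma>) +
      (root_transport (Q s t) (edge_path \<sigma> 1) (\<phi> (edge_path \<sigma> 1)) -
       root_transport (Q s t) (edge_path \<sigma> 0) (\<phi> (edge_path \<sigma> 0)))) z"
  proof (rule weight_sum_cong)
    fix \<sigma> assume \<sigma>: "\<sigma> \<in> Poly_Mapping.keys z"
    have "Q s t field_differentiable at x" for x
      using has_field_derivative_Q field_differentiable_def by blast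
    from polygon_integral_shadow[OF m[OF \<sigma>] r[OF \<sigma>] shadow[OF \<sigma>] this]
    show "polygon_integral ?f (Q s t) N (?k \<sigma>) = polygon_integral ?f (Q s t) N (edge_path \<sigma>) +
      (root_transport (Q s t) (edge_path \<sigma> 1) (\<phi> (edge_path \<sigma> 1)) -
       root_transport (Q s t) (edge_path \<sigma> 0) (\<phi> (edge_path \<sigma> 0)))"
      using k[of 0 \<sigma>] k[of 1 \<sigma>] by simp
  qed
  \<comment> \<open>The transport term depends on an endpoint \<open>p\<close> only through
    \<open>p\<close> and \<open>\<phi> p\<close>, so it is a function of vertices and cancels over
    the cycle.\<close>
  also have "\<dots> = weight_sum (\<lambda>\<sigma>. polygon_integral ?f (Q s t) N (edge_path \<sigma>)) z + 0"
    by (simp only: weight_sum_add_fun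
        weight_sum_boundary[OF z(2), of "\<lambda>p. root_transport (Q s t) p (\<phi> p)"])
  finally show ?thesis by simp
qed

text \<open>For small \<open>h\<close> the period is a sum over fixed polygons; it is differentiated
  there, and the result is read back as an integral along \<open>z\<close>. The direction
  \<open>(\<alpha>, \<beta>)\<close> covers both partial derivatives at once.\<close>

lemma Z0_variation:
  assumes z: "singular_chain 1 (top_of_set (E a b)) z" "chain_boundary 1 z = 0" "admissible z"
    and U: "open U" "(a, b) \<in> U" and \<Gamma>: "locally_constant_cycle U a b z \<Gamma>"
  shows "((\<lambda>h. Z0 (\<Gamma> (a + h * \<alpha>) (b + h * \<beta>))) has_field_derivative
     chain_integral_dx (\<lambda>(x, y). (\<alpha> * x + \<beta>) / (2 * y)) z) (at 0)"
proof -
  note on_E = singular_chain_edge_path[OF z(1)]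
  obtain \<rho> d N where m: "\<rho> > 0" "d > 0"
    "\<And>\<sigma>. \<sigma> \<in> Poly_Mapping.keys z \<Longrightarrow> fine_mesh \<rho> d N (edge_path \<sigma>)"
    "\<And>\<sigma> s t. \<sigma> \<in> Poly_Mapping.keys z \<Longrightarrow> dist (s, t) (a, b) < d \<Longrightarrow> root_region \<rho> d (Q s t) (edge_path \<sigma>)"
    using admissible_fine_mesh[OF z(3) on_E] by blast
  obtain \<phi> where \<phi>: "continuous_on (U \<times> chain_support z) (\<lambda>(w, p). \<phi> w p)"
      "\<And>p. p \<in> chain_support z \<Longrightarrow> \<phi> (a, b) p = p"
      "\<And>s t. (s, t) \<in> U \<Longrightarrow> \<phi> (s, t) ` chain_support z \<subseteq> E s t \<and>
           \<Gamma> s t = chain_map 1 (\<phi> (s, t)) z \<and> admissible (\<Gamma> s t)"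
    using \<Gamma> unfolding locally_constant_cycle_def by fast
  have "continuous_on {0..1} (edge_path \<sigma>)" if "\<sigma> \<in> Poly_Mapping.keys z" for \<sigma>
    using z(3) that by (auto simp: admissible_def valid_path_def piecewise_C1_differentiable_on_def)
  then have comp: "compact (chain_support z)"
    unfolding chain_support_eq by (intro compact_UN finite_keys compact_continuous_image) auto
  obtain r where r: "r > 0" "cball (a, b) r \<subseteq> U" using U open_contains_cball by blast
  have "uniformly_continuous_on (cball (a, b) r \<times> chain_support z) (\<lambda>(w, p). \<phi> w p)"
    using r(2) by (intro compact_uniformly_continuous compact_Times comp compact_cball continuous_on_subset[OF \<phi>(1)]) auto
  moreover have "min (d / 2) (\<rho> / 8) > 0" using m(1,2) by simp
  ultimately have "\<exists>e>0. \<forall>v\<in>cball (a, b) r \<times> chain_support z. \<forall>v'\<in>cball (a, b) r \<times> chain_support z.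
      dist v' v < e \<longrightarrow> dist (case v' of (w, p) \<Rightarrow> \<phi> w p) (case v of (w, p) \<Rightarrow> \<phi> w p) < min (d / 2) (\<rho> / 8)"
    unfolding uniformly_continuous_on_def by blast
  then obtain e where e: "e > 0" "\<And>v v'. v \<in> cball (a, b) r \<times> chain_support z \<Longrightarrow>
      v' \<in> cball (a, b) r \<times> chain_support z \<Longrightarrow> dist v' v < e \<Longrightarrow>
      dist (case v' of (w, p) \<Rightarrow> \<phi> w p) (case v of (w, p) \<Rightarrow> \<phi> w p) < min (d / 2) (\<rho> / 8)"
    by blast
  \<comment> \<open>Compare parameter \<open>w\<close> with \<open>(a, b)\<close>, where
    \<open>\<phi>\<close> fixes the support.\<close>
  have near: "dist (\<phi> w p) p < min (d / 2) (\<rho> / 8)"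
    if "p \<in> chain_support z" "dist w (a, b) < r" "dist w (a, b) < e" for w p
    using e(2)[of "((a, b), p)" "(w, p)"] that r(1) \<phi>(2)[of p]
    by (simp add: dist_Pair_Pair dist_commute)
  \<comment> \<open>\<open>d\<close> controls the root regions, \<open>r\<close> keeps the
    parameters in \<open>U\<close>, and \<open>e\<close> bounds the displacement of the
    cycle.\<close>
  define \<eta> where "\<eta> = min d (min r e)"
  have Z0: "Z0 (\<Gamma> s t) = weight_sum (\<lambda>\<sigma>. polygon_integral (\<lambda>(x, y). y) (Q s t) N (edge_path \<sigma>)) z"
    if "dist (s, t) (a, b) < \<eta>" for s t
  proof -
    have st: "dist (s, t) (a, b) < d" "dist (s, t) (a, b) < r" "dist (s, t) (a, b) < e"
      using that by (auto simp: \<eta>_def)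
    then have "(s, t) \<in> U" using r(2) by (auto simp: dist_commute)
    note P = \<phi>(3)[OF this]
    show ?thesis
      using P Z0_chain_map[OF z(1,2) m(3) m(4)[OF _ st(1)] near[OF _ st(2,3)]] by metis
  qed
  have "((\<lambda>h. (a + h * \<alpha>, b + h * \<beta>)) \<longlongrightarrow> (a + 0 * \<alpha>, b + 0 * \<beta>)) (nhds 0)"
    by (intro tendsto_intros filterlim_ident)
  moreover have "\<eta> > 0" using m r e by (simp add: \<eta>_def)
  ultimately have "eventually (\<lambda>h. dist (a + h * \<alpha>, b + h * \<beta>) (a, b) < \<eta>) (nhds 0)"
    unfolding tendsto_iff by simp
  then obtain \<epsilon> where \<epsilon>: "\<epsilon> > 0" "\<And>h. h \<in> ball 0 \<epsilon> \<Longrightarrow> dist (a + h * \<alpha>, b + h * \<beta>) (a, b) < \<eta>"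
    unfolding eventually_nhds_metric by (auto simp: dist_commute)
  have "((\<lambda>h. weight_sum (\<lambda>\<sigma>. polygon_integral (\<lambda>(x, y). y) (Q (a + h * \<alpha>) (b + h * \<beta>)) N (edge_path \<sigma>)) z)
      has_field_derivative weight_sum (\<lambda>\<sigma>. integral_dx (\<lambda>(x, y). (\<alpha> * x + \<beta>) / (2 * y)) (edge_path \<sigma>)) z) (at 0)"
  proof (rule weight_sum_has_field_derivative)
    fix \<sigma> assume \<sigma>: "\<sigma> \<in> Poly_Mapping.keys z"
    let ?f = "\<lambda>(x, y). (\<alpha> * x + \<beta>) / (2 * y)"
    have "adapted (Q a b) (edge_path \<sigma>) N (\<lambda>i. ball (fst (edge_path \<sigma> (i / N))) d)"
      using m \<sigma> on_E[OF \<sigma>] by (intro shadows_adapted shadows_self) auto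
    moreover have "valid_path (edge_path \<sigma>)" using z(3) \<sigma> by (simp add: admissible_def)
    ultimately have "(edge_integrand ?f (edge_path \<sigma>) has_integral polygon_integral ?f (Q a b) N (edge_path \<sigma>)) {0..1}"
      using branch_Q_differentiable branch_nonzero
      by (intro edge_integrand_has_integral_polygon) (auto intro!: derivative_intros)
    then have "integral_dx ?f (edge_path \<sigma>) = polygon_integral ?f (Q a b) N (edge_path \<sigma>)"
      by (simp add: integral_dx_eq integral_unique)
    moreover have "root_region \<rho> d (Q (a + h * \<alpha>) (b + h * \<beta>)) (edge_path \<sigma>)" if "h \<in> ball 0 \<epsilon>" for h
      using \<epsilon>(2)[OF that] by (intro m(4)[OF \<sigma>]) (simp add: \<eta>_def)
    ultimately show "((\<lambda>h. polygon_integral (\<lambda>(x, y). y) (Q (a + h * \<alpha>) (b + h * \<beta>)) N (edge_path \<sigma>))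
        has_field_derivative integral_dx ?f (edge_path \<sigma>)) (at 0)"
      using polygon_integral_root_derivative[OF m(3)[OF \<sigma>] \<epsilon>(1)] by simp
  qed
  then show ?thesis
    unfolding chain_integral_dx_eq
    by (rule has_field_derivative_transform_within_open[of _ _ _ "ball 0 \<epsilon>"])
       (use \<epsilon> Z0 in auto)
qed

lemma chain_integral_dx_cmult: "chain_integral_dx (\<lambda>p. r * f p) z = r * chain_integral_dx f z"
proof -
  have "edge_integrand (\<lambda>p. r * f p) g = (\<lambda>t. r * edge_integrand f g t)" for g
    by (simp add: edge_integrand_def fun_eq_iff)
  then show ?thesis
    unfolding chain_integral_dx_eq integral_dx_eq by (simp add: weight_sum_cmult_fun)
qed

text \<open>Near \<open>a\<close> the imaginary part of \<open>L s - L a\<close> is below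
  \<open>pi\<close> in absolute value, so this difference is the principal logarithm of
  \<open>f s / f a\<close>. Continuity of the logarithm thus gives its differentiability.\<close>

lemma has_field_derivative_continuous_log:
  fixes L f :: "complex \<Rightarrow> complex"
  assumes V: "open V" "a \<in> V" "continuous_on V L" and L: "\<And>s. s \<in> V \<Longrightarrow> exp (L s) = f s"
    and f: "(f has_field_derivative f') (at a)"
  shows "(L has_field_derivative f' / f a) (at a)"
proof -
  have "isCont L a" using V by (simp add: continuous_on_eq_continuous_at)
  then have "eventually (\<lambda>s. dist (L s) (L a) < pi) (nhds a)"
    unfolding isCont_def tendsto_at_iff_tendsto_nhds by (rule tendstoD) simp
  moreover have "eventually (\<lambda>s. s \<in> V) (nhds a)" using V eventually_nhds by blast
  ultimately have ev: "eventually (\<lambda>s. L s = L a + Ln (f s / f a)) (nhds a)"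
  proof eventually_elim
    case (elim s)
    then have "\<bar>Im (L s - L a)\<bar> < pi"
      using abs_Im_le_cmod[of "L s - L a"] by (simp add: dist_norm)
    then have "Ln (exp (L s - L a)) = L s - L a" by (intro Ln_exp) auto
    then show ?case using elim V(2) by (simp add: exp_diff L)
  qed
  have nz: "f a \<noteq> 0" using L[OF V(2)] by (metis exp_not_eq_zero)
  have "((\<lambda>s. L a + Ln (f s / f a)) has_field_derivative f' / f a) (at a)"
    using nz by (auto intro!: derivative_eq_intros f)
  then show ?thesis
    using DERIV_cong_ev[OF refl ev refl] by blast
qed

text \<open>The logarithm of the discriminant is any continuous \<open>L\<close> with exponential
  \<open>Disc\<close> on \<open>U\<close>. Since \<open>deriv\<close> is total, differentiability of
  all four functions in the bracket is asserted too.\<close>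

theorem mainTheorem11:
  fixes a b :: complex
    and \<gamma> :: "(complex \<times> complex) chain set"
    and z :: "(complex \<times> complex) chain"
  assumes "Disc a b \<noteq> 0"
    and "\<gamma> \<in> carrier (H1 a b)"
    and "z \<in> \<gamma>" and "admissible z"
  shows "Z2 a b z = a ^ 2 / (4 * Disc a b) * A z - 9 * b / (8 * Disc a b) * B z \<and>
    (\<forall>U L \<Gamma>.
       open U \<and> (a, b) \<in> U \<and>
       continuous_on U (\<lambda>(s, t). L s t) \<and> (\<forall>(s, t)\<in>U. exp (L s t) = Disc s t) \<and>
       locally_constant_cycle U a b z \<Gamma> \<longrightarrow>
         (\<lambda>s. L s b) field_differentiable at a \<and> (\<lambda>t. L a t) field_differentiable at b \<and>
         (\<lambda>s. Z0 (\<Gamma> s b)) field_differentiable at a \<and> (\<lambda>t. Z0 (\<Gamma> a t)) field_differentiable at b \<and>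
         Z2 a b z = 1 / 24 * poisson_bracket L (\<lambda>s t. Z0 (\<Gamma> s t)) a b)"
proof (intro conjI allI impI)
  note z = homology_class_cycle[OF assms(2,3)] assms(4)
  show Z2: "Z2 a b z = a ^ 2 / (4 * Disc a b) * A z - 9 * b / (8 * Disc a b) * B z"
    by (rule Z2_eq_A_B[OF assms(1) z])
  fix U L \<Gamma>
  assume *: "open U \<and> (a, b) \<in> U \<and>
       continuous_on U (\<lambda>(s, t). L s t) \<and> (\<forall>(s, t)\<in>U. exp (L s t) = Disc s t) \<and>
       locally_constant_cycle U a b z \<Gamma>"
  then have U: "open U" "(a, b) \<in> U" "continuous_on U (\<lambda>(s, t). L s t)"
    and L: "\<And>s t. (s, t) \<in> U \<Longrightarrow> exp (L s t) = Disc s t"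
    and \<Gamma>: "locally_constant_cycle U a b z \<Gamma>" by auto
  \<comment> \<open>Restrict to the slice of \<open>U\<close> with second coordinate
    \<open>b\<close>, on which \<open>L s b\<close> is a continuous logarithm of
    \<open>Disc s b\<close>.\<close>
  have La: "((\<lambda>s. L s b) has_field_derivative 12 * a ^ 2 / Disc a b) (at a)"
  proof (rule has_field_derivative_continuous_log)
    show "open ((\<lambda>s. (s, b)) -` U)"
      by (intro open_vimage U continuous_intros)
    show "continuous_on ((\<lambda>s. (s, b)) -` U) (\<lambda>s. L s b)"
      using continuous_on_compose2[OF U(3), of "(\<lambda>s. (s, b)) -` U" "\<lambda>s. (s, b)"]
      by (auto simp: continuous_on_Pair)
    show "((\<lambda>s. Disc s b) has_field_derivative 12 * a ^ 2) (at a)"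
      unfolding Disc_def by (auto intro!: derivative_eq_intros)
  qed (use U L in auto)
  have Lb: "((\<lambda>t. L a t) has_field_derivative 54 * b / Disc a b) (at b)"
  proof (rule has_field_derivative_continuous_log)
    show "open ((\<lambda>t. (a, t)) -` U)"
      by (intro open_vimage U continuous_intros)
    show "continuous_on ((\<lambda>t. (a, t)) -` U) (\<lambda>t. L a t)"
      using continuous_on_compose2[OF U(3), of "(\<lambda>t. (a, t)) -` U" "\<lambda>t. (a, t)"]
      by (auto simp: continuous_on_Pair)
    show "((\<lambda>t. Disc a t) has_field_derivative 54 * b) (at b)"
      unfolding Disc_def by (auto intro!: derivative_eq_intros)
  qed (use U L in auto)
  have Za': "chain_integral_dx (\<lambda>(x, y). (1 * x + 0) / (2 * y)) z = 1 / 2 * B z"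
    unfolding B_def chain_integral_dx_cmult[symmetric] by (simp add: case_prod_unfold)
  \<comment> \<open>The variation in direction (1, 0) at \<open>h = 0\<close>, shifted to a
    derivative at \<open>a\<close>; direction (0, 1) is used for \<open>b\<close>.\<close>
  have Za: "((\<lambda>s. Z0 (\<Gamma> s b)) has_field_derivative 1 / 2 * B z) (at a)"
    using Z0_variation[OF z U(1,2) \<Gamma>, of 1 0, unfolded Za'] DERIV_shift[of "\<lambda>s. Z0 (\<Gamma> s b)" _ 0 a]
    by (simp add: add.commute)
  have Zb': "chain_integral_dx (\<lambda>(x, y). (0 * x + 1) / (2 * y)) z = 1 / 2 * A z"
    unfolding A_def chain_integral_dx_cmult[symmetric] by (simp add: case_prod_unfold)
  have Zb: "((\<lambda>t. Z0 (\<Gamma> a t)) has_field_derivative 1 / 2 * A z) (at b)"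
    using Z0_variation[OF z U(1,2) \<Gamma>, of 0 1, unfolded Zb'] DERIV_shift[of "\<lambda>t. Z0 (\<Gamma> a t)" _ 0 b]
    by (simp add: add.commute)
  show "(\<lambda>s. L s b) field_differentiable at a" "(\<lambda>t. L a t) field_differentiable at b"
    "(\<lambda>s. Z0 (\<Gamma> s b)) field_differentiable at a" "(\<lambda>t. Z0 (\<Gamma> a t)) field_differentiable at b"
    using La Lb Za Zb field_differentiable_def by blast+
  \<comment> \<open>The coefficients are 12 / (24 * 2) = 1/4 for \<open>A\<close> and 54 / (24 * 2)
    = 9/8 for \<open>B\<close>.\<close>
  show "Z2 a b z = 1 / 24 * poisson_bracket L (\<lambda>s t. Z0 (\<Gamma> s t)) a b"
    unfolding poisson_bracket_def Z2 DERIV_imp_deriv[OF La] DERIV_imp_deriv[OF Lb]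
      DERIV_imp_deriv[OF Za] DERIV_imp_deriv[OF Zb]
    using assms(1) by (simp add: field_simps)
qed

end
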